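(* Let $u\in H(\mathbb D)$ and $\varphi\in S(\mathbb D)$, and suppose $uC_\varphi$ is bounded on $\mathcal B$. Then \[ \|uC_\varphi\|_{\mathcal B\to\mathcal B}\approx |u(0)|\log\frac{2}{1-|\varphi(0)|^2}+\sup_{n\ge0}\|u\varphi^n\|_{\mathcal B}+\sup_{a\in\mathbb D}\log\frac{2}{1-|\varphi(a)|^2}\,\|u\circ\sigma_a-u(a)\|_{A^2}. \]
   Context: $\mathbb D$ is the open unit disk, $H(\mathbb D)$ the analytic functions on $\mathbb D$, and $S(\mathbb D)$ the set of analytic self-maps of $\mathbb D$. For $a\in\mathbb D$, $\sigma_a(z)=\frac{a-z}{1-\bar a z}$. $dA=\frac1\pi\,dx\,dy$ is normalized area measure on $\mathbb D$, and $\|f\|_{A^2}=(\int_{\mathbb D}|f|^2\,dA)^{1/2}$. The Bloch space $\mathcal B$ consists of $f\in H(\mathbb D)$ with $\sup_{z\in\mathbb D}(1-|z|^2)|f'(z)|<\infty$, normed by $\|f\|_{\mathcal B}=|f(0)|+\sup_{z}(1-|z|^2)|f'(z)|$. $(uC_\varphi f)(z)=u(z)f(\varphi(z))$, and $u\varphi^n$ denotes the function $z\mapsto u(z)\varphi(z)^n$. $X\approx Y$ means there are positive constants $c,C$ independent of $u$ and $\varphi$ with $cY\le X\le CY$. *)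

theory Defs
  imports "HOL-Analysis.Analysis"
begin

text \<open>The unit disk is \<open>ball 0 1\<close>. Functions on the disk are modelled as total
  functions \<open>complex \<Rightarrow> complex\<close>; only their values on the disk matter.
  Norms are valued in \<open>ennreal\<close> so that infinite values are represented faithfully.\<close>

definition self_map_disk :: "(complex \<Rightarrow> complex) \<Rightarrow> bool" where
  "self_map_disk \<phi> \<longleftrightarrow> \<phi> holomorphic_on ball 0 1 \<and> \<phi> ` ball 0 1 \<subseteq> ball 0 1"

definition disk_automorphism :: "complex \<Rightarrow> complex \<Rightarrow> complex" where
  "disk_automorphism a z = (a - z) / (1 - cnj a * z)"

definition bloch_norm :: "(complex \<Rightarrow> complex) \<Rightarrow> ennreal" where
  "bloch_norm f = ennreal (cmod (f 0)) +
     (SUP z\<in>ball 0 1. ennreal ((1 - (cmod z)\<^sup>2) * cmod (deriv f z)))"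

definition in_bloch :: "(complex \<Rightarrow> complex) \<Rightarrow> bool" where
  "in_bloch f \<longleftrightarrow> f holomorphic_on ball 0 1 \<and> bloch_norm f < \<infinity>"

text \<open>\<open>A^2\<close> norm with respect to normalized area measure \<open>dA = dx dy / pi\<close>.\<close>
definition A2_norm :: "(complex \<Rightarrow> complex) \<Rightarrow> ennreal" where
  "A2_norm f = (let I = (\<integral>\<^sup>+ z. ennreal ((cmod (f z))\<^sup>2) * indicator (ball 0 1) z \<partial>lborel)
                in if I = \<infinity> then \<infinity> else ennreal (sqrt (enn2real I / pi)))"

definition wcomp :: "(complex \<Rightarrow> complex) \<Rightarrow> (complex \<Rightarrow> complex) \<Rightarrow> (complex \<Rightarrow> complex) \<Rightarrow> (complex \<Rightarrow> complex)" where
  "wcomp u \<phi> f = (\<lambda>z. u z * f (\<phi> z))"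

definition wcomp_bounded_bloch :: "(complex \<Rightarrow> complex) \<Rightarrow> (complex \<Rightarrow> complex) \<Rightarrow> bool" where
  "wcomp_bounded_bloch u \<phi> \<longleftrightarrow>
     (\<exists>M::real. \<forall>f. in_bloch f \<longrightarrow>
        in_bloch (wcomp u \<phi> f) \<and> bloch_norm (wcomp u \<phi> f) \<le> ennreal M * bloch_norm f)"

definition wcomp_opnorm_bloch :: "(complex \<Rightarrow> complex) \<Rightarrow> (complex \<Rightarrow> complex) \<Rightarrow> ennreal" where
  "wcomp_opnorm_bloch u \<phi> =
     (SUP f\<in>{f. in_bloch f \<and> bloch_norm f \<le> 1}. bloch_norm (wcomp u \<phi> f))"

end

theory Submission
  imports Defs "HOL-Complex_Analysis.Complex_Analysis"
begin

text \<open>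
  Write \<open>\<sigma>\<^sub>a\<close> for \<open>disk_automorphism a\<close>, \<open>\<lambda>(z) = - ln (1 - |z|)\<close>, \<open>L(w) = ln (2 / (1 - |w|\<^sup>2))\<close>, and
  \<open>N\<close> for the operator norm. Moebius invariance of the Bloch seminorm gives
  \<open>|f (\<sigma>\<^sub>a z) - f a| \<le> \<beta>(f) \<lambda>(z)\<close>, and \<open>\<lambda>\<close> has all its powers integrable on the disk.

  Lower bound for the third term: put \<open>b = \<phi> a\<close>, \<open>f(w) = ln 2 - Ln (1 - cnj b * w)\<close>, so that \<open>f b = L(b)\<close>,
  and \<open>w = \<sigma>\<^sub>b (\<phi> (\<sigma>\<^sub>a z))\<close>, so that \<open>|w| \<le> |z|\<close> by the Schwarz lemma. Then \<open>L(b) (u (\<sigma>\<^sub>a z) - u a)\<close> is the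
  oscillation of \<open>uC\<^sub>\<phi> f\<close>, at most \<open>3 N \<lambda>(z)\<close>, minus \<open>u (\<sigma>\<^sub>a z) (f (\<phi> (\<sigma>\<^sub>a z)) - f b)\<close>. The last factor
  is at most \<open>2 \<lambda>(w) \<le> 2 |w| (1 + \<lambda>(z))\<close>, and \<open>u (\<sigma>\<^sub>a z) w\<close> is the value at \<open>\<sigma>\<^sub>a z\<close> of
  \<open>uC\<^sub>\<phi> \<sigma>\<^sub>b\<close>, which vanishes at \<open>a\<close>, so it is at most \<open>2 N \<lambda>(z)\<close>. This is a pointwise bound
  by \<open>N\<close> times a polynomial in \<open>\<lambda>(z)\<close>.

  Upper bound: the term \<open>u' f(\<phi>)\<close> of the derivative is controlled by \<open>|f| \<le> 2 L\<close> and
  \<open>(1 - |a|\<^sup>2) |u'(a)| = |(u \<circ> \<sigma>\<^sub>a)'(0)| \<le> 3 \<parallel>u \<circ> \<sigma>\<^sub>a - u a\<parallel>\<close> in \<open>A\<^sup>2\<close>; the term \<open>u \<phi>' f'(\<phi>)\<close> by \<open>u\<phi>\<^sup>n\<close> with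
  \<open>n\<close> of the order of \<open>1 / (1 - |\<phi>(z)|)\<close>.
\<close>

subsection \<open>Disk automorphisms and Bloch functions\<close>

lemma one_minus_cnj_mult_nonzero:
  assumes "a \<in> ball 0 1" "z \<in> ball 0 1"
  shows "1 - cnj a * z \<noteq> 0"
proof
  assume "1 - cnj a * z = 0"
  then have "cmod a * cmod z = 1"
    by (metis complex_mod_cnj eq_iff_diff_eq_0 norm_mult norm_one)
  moreover have "cmod a * cmod z < 1 * 1"
    using assms by (intro mult_strict_mono') auto
  ultimately show False by simp
qed

text \<open>This is \<open>|1 - cnj a * z|^2 - |a - z|^2 = (1 - |a|^2) * (1 - |z|^2)\<close> divided
  by the first square. Positivity of the right side yields the self-map property, and comparison
  with the derivative yields Moebius invariance.\<close>

lemma one_minus_disk_automorphism_norm_square: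
  assumes "a \<in> ball 0 1" "z \<in> ball 0 1"
  shows "1 - (cmod (disk_automorphism a z))\<^sup>2
         = (1 - (cmod a)\<^sup>2) * (1 - (cmod z)\<^sup>2) / (cmod (1 - cnj a * z))\<^sup>2"
proof -
  have "(cmod (1 - cnj a * z))\<^sup>2 - (cmod (a - z))\<^sup>2 = (1 - (cmod a)\<^sup>2) * (1 - (cmod z)\<^sup>2)"
    unfolding cmod_power2 by (simp add: algebra_simps power2_eq_square)
  then show ?thesis
    using one_minus_cnj_mult_nonzero[OF assms]
    by (simp add: disk_automorphism_def norm_divide power_divide field_simps)
qed

lemma disk_automorphism_in_disk:
  assumes "a \<in> ball 0 1" "z \<in> ball 0 1"
  shows "disk_automorphism a z \<in> ball 0 1"
proof -
  have "(1 - (cmod a)\<^sup>2) * (1 - (cmod z)\<^sup>2) / (cmod (1 - cnj a * z))\<^sup>2 > 0"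
    using assms one_minus_cnj_mult_nonzero[OF assms]
    by (intro divide_pos_pos mult_pos_pos) (auto simp: power_less_one_iff abs_square_less_1)
  then show ?thesis
    using one_minus_disk_automorphism_norm_square[OF assms]
    by (metis abs_norm_cancel abs_square_less_1 diff_gt_0_iff_gt mem_ball_0)
qed

lemma disk_automorphism_0 [simp]: "disk_automorphism a 0 = a"
  and disk_automorphism_self [simp]: "disk_automorphism a a = 0"
  by (simp_all add: disk_automorphism_def)

lemma disk_automorphism_involution:
  assumes "a \<in> ball 0 1" "z \<in> ball 0 1"
  shows "disk_automorphism a (disk_automorphism a z) = z"
proof -
  have nz: "1 - cnj a * z \<noteq> 0" "1 - cnj a * a \<noteq> 0"
    using assms one_minus_cnj_mult_nonzero by auto
  have "1 - cnj a * ((a - z) / (1 - cnj a * z)) = (1 - cnj a * a) / (1 - cnj a * z)"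
    using nz by (simp add: field_simps)
  moreover have "a - (a - z) / (1 - cnj a * z) = z * (1 - cnj a * a) / (1 - cnj a * z)"
    using nz by (simp add: field_simps)
  ultimately show ?thesis
    using nz by (simp add: disk_automorphism_def)
qed

lemma has_field_derivative_disk_automorphism:
  assumes "a \<in> ball 0 1" "z \<in> ball 0 1"
  shows "(disk_automorphism a has_field_derivative
           - complex_of_real (1 - (cmod a)\<^sup>2) / (1 - cnj a * z)\<^sup>2) (at z)"
proof -
  have nz: "1 - cnj a * z \<noteq> 0"
    using assms one_minus_cnj_mult_nonzero by auto
  have "((\<lambda>z. (a - z) / (1 - cnj a * z)) has_field_derivative
          ((0 - 1) * (1 - cnj a * z) - (a - z) * (0 - cnj a * 1)) / ((1 - cnj a * z) * (1 - cnj a * z))) (at z)"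
    using nz by (intro derivative_intros) auto
  moreover have "complex_of_real (1 - (cmod a)\<^sup>2) = 1 - cnj a * a"
    by (simp add: complex_norm_square[symmetric] mult.commute)
  ultimately show ?thesis
    unfolding disk_automorphism_def[abs_def]
    by (simp add: algebra_simps power2_eq_square minus_divide_left)
qed

lemma holomorphic_on_disk_automorphism:
  "a \<in> ball 0 1 \<Longrightarrow> disk_automorphism a holomorphic_on ball 0 1"
  using has_field_derivative_disk_automorphism holomorphic_on_open open_ball by blast

text \<open>Equality case of Schwarz-Pick. It makes the Bloch seminorm Moebius invariant and shows
  that every disk automorphism has seminorm at most 1.\<close>

lemma deriv_disk_automorphism_norm:
  assumes "a \<in> ball 0 1" "z \<in> ball 0 1"
  shows "(1 - (cmod z)\<^sup>2) * cmod (deriv (disk_automorphism a) z)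
         = 1 - (cmod (disk_automorphism a z))\<^sup>2"
proof -
  have "(cmod a)\<^sup>2 \<le> 1"
    using assms by (auto simp: abs_square_le_1)
  then have "cmod (deriv (disk_automorphism a) z) = (1 - (cmod a)\<^sup>2) / (cmod (1 - cnj a * z))\<^sup>2"
    unfolding DERIV_imp_deriv[OF has_field_derivative_disk_automorphism[OF assms]]
    by (simp only: norm_divide norm_minus_cancel norm_power norm_of_real abs_of_nonneg diff_ge_0_iff_ge)
  then show ?thesis
    unfolding one_minus_disk_automorphism_norm_square[OF assms] by simp
qed

section \<open>Growth of Bloch functions and elementary logarithm inequalities\<close>

lemma bloch_growth:
  assumes holf: "f holomorphic_on ball 0 1"
    and B: "\<And>z. z \<in> ball 0 1 \<Longrightarrow> (1 - (cmod z)\<^sup>2) * cmod (deriv f z) \<le> B"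
    and z: "z \<in> ball 0 1"
  shows "cmod (f z - f 0) \<le> B * (- ln (1 - cmod z))"
proof -
  define g where "g t = f (complex_of_real t * z)" for t
  define G where "G t = B * (- ln (1 - t * cmod z))" for t
  have r: "cmod z < 1" using z by simp
  have lt: "t * cmod z < 1" if "t \<in> {0..1}" for t
    using that r by (smt (verit) atLeastAtMost_iff mult_left_le_one_le norm_ge_zero)
  have in_disk: "complex_of_real t * z \<in> ball 0 1" if "t \<in> {0..1}" for t
    using lt[OF that] that by (simp add: norm_mult)
  have dg: "(g has_vector_derivative (deriv f (complex_of_real t * z) * z)) (at t within X)"
    if "t \<in> {0..1}" for t X
  proof -
    have "(f has_field_derivative deriv f (complex_of_real t * z)) (at (complex_of_real t * z))"
      using holf in_disk[OF that] holomorphic_derivI open_ball by blast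
    moreover have "((\<lambda>t. complex_of_real t * z) has_vector_derivative z) (at t within X)"
      by (auto intro!: derivative_eq_intros)
    ultimately show ?thesis
      unfolding g_def using field_vector_diff_chain_within[of "\<lambda>t. complex_of_real t * z" z t X f
          "deriv f (complex_of_real t * z)"] has_field_derivative_at_within
      by (auto simp: o_def mult.commute)
  qed
  have dG: "(G has_vector_derivative (B * (cmod z / (1 - t * cmod z)))) (at t within X)"
    if "t \<in> {0..1}" for t X
    unfolding G_def has_real_derivative_iff_has_vector_derivative[symmetric]
    using lt[OF that] by (auto intro!: derivative_eq_intros simp: field_simps)
  have "norm (g 1 - g 0) \<le> G 1 - G 0"
  proof (rule differentiable_bound_general)
    show "continuous_on {0..1} g"
      using dg by (meson continuous_on_vector_derivative)
    show "continuous_on {0..1} G"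
      using dG by (meson continuous_on_vector_derivative)
    fix t :: real assume t: "0 < t" "t < 1"
    then have t': "t \<in> {0..1}" by simp
    show "(g has_vector_derivative (deriv f (complex_of_real t * z) * z)) (at t)"
      by (rule dg[OF t'])
    show "(G has_vector_derivative (B * (cmod z / (1 - t * cmod z)))) (at t)"
      by (rule dG[OF t'])
    \<comment> \<open>The weight \<open>1 - (t * |z|)^2\<close> is weakened to
      \<open>1 - t * |z|\<close>, for which the majorant of the radial derivative has the elementary
      primitive \<open>G\<close>.\<close>
    have "(1 - t * cmod z) * cmod (deriv f (complex_of_real t * z))
          \<le> (1 - (t * cmod z)\<^sup>2) * cmod (deriv f (complex_of_real t * z))"
      using lt[OF t'] t by (intro mult_right_mono) (auto simp: power2_eq_square mult_left_le_one_le)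
    also have "\<dots> \<le> B"
      using B[OF in_disk[OF t']] t by (simp add: norm_mult)
    finally have "cmod (deriv f (complex_of_real t * z)) \<le> B / (1 - t * cmod z)"
      using lt[OF t'] by (simp add: field_simps)
    then show "norm (deriv f (complex_of_real t * z) * z) \<le> B * (cmod z / (1 - t * cmod z))"
      using mult_right_mono[of _ _ "cmod z"] by (fastforce simp: norm_mult)
  qed auto
  then show ?thesis
    by (simp add: g_def G_def)
qed

text \<open>Precomposition with \<open>disk_automorphism a\<close> keeps the bound \<open>B\<close>
  by the chain rule and sends 0 to \<open>a\<close>, so the growth estimate at the origin
  transfers.\<close>

lemma bloch_growth_disk_automorphism:
  assumes holf: "f holomorphic_on ball 0 1"
    and B: "\<And>z. z \<in> ball 0 1 \<Longrightarrow> (1 - (cmod z)\<^sup>2) * cmod (deriv f z) \<le> B"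
    and a: "a \<in> ball 0 1" and z: "z \<in> ball 0 1"
  shows "cmod (f (disk_automorphism a z) - f a) \<le> B * (- ln (1 - cmod z))"
proof -
  let ?g = "\<lambda>z. f (disk_automorphism a z)"
  have holg: "?g holomorphic_on ball 0 1"
    using holomorphic_on_compose_gen[OF holomorphic_on_disk_automorphism[OF a] holf]
      disk_automorphism_in_disk[OF a] by (simp add: o_def image_subset_iff)
  have "(1 - (cmod z)\<^sup>2) * cmod (deriv ?g z) \<le> B" if z: "z \<in> ball 0 1" for z
  proof -
    have "deriv ?g z = deriv f (disk_automorphism a z) * deriv (disk_automorphism a) z"
      using deriv_chain[of "disk_automorphism a" z f, unfolded o_def]
        holf holomorphic_on_disk_automorphism[OF a] z disk_automorphism_in_disk[OF a z]
        holomorphic_on_imp_differentiable_at open_ball by blast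
    then have "(1 - (cmod z)\<^sup>2) * cmod (deriv ?g z)
          = (1 - (cmod (disk_automorphism a z))\<^sup>2) * cmod (deriv f (disk_automorphism a z))"
      using deriv_disk_automorphism_norm[OF a z] by (simp add: norm_mult)
    also have "\<dots> \<le> B"
      by (rule B[OF disk_automorphism_in_disk[OF a z]])
    finally show ?thesis .
  qed
  from bloch_growth[OF holg this z] show ?thesis by simp
qed

lemma neg_ln_one_minus_le_ln:
  assumes "0 \<le> x" "x < (1::real)"
  shows "- ln (1 - x) \<le> ln (2 / (1 - x\<^sup>2))"
proof -
  have "(1 - x) * (1 + x) \<le> (1 - x) * 2"
    using assms by (intro mult_left_mono) auto
  then have "1 - x\<^sup>2 \<le> 2 * (1 - x)" 
    by (simp add: power2_eq_square algebra_simps)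
  moreover have x2: "x\<^sup>2 < 1"
    using assms by (metis abs_of_nonneg abs_square_less_1)
  moreover have "0 < 1 - x\<^sup>2" "0 < 2 * (1 - x)"
    using assms x2 by simp_all
  ultimately have "2 / (2 * (1 - x)) \<le> 2 / (1 - x\<^sup>2)"
    by (intro divide_left_mono mult_pos_pos) simp_all
  then have le: "1 / (1 - x) \<le> 2 / (1 - x\<^sup>2)"
    by (metis mult.right_neutral mult_divide_mult_cancel_left zero_neq_numeral)
  have "- ln (1 - x) = ln (1 / (1 - x))"
    using assms by (simp add: ln_div)
  also have "\<dots> \<le> ln (2 / (1 - x\<^sup>2))"
    using assms by (intro ln_mono le divide_pos_pos) simp_all
  finally show ?thesis .
qed

text \<open>In terms of \<open>t = - ln (1 - x)\<close> this is
  \<open>exp (-t) * (1 + t) <= 1\<close>. The factor \<open>x\<close> split off here is what later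
  pairs with \<open>u\<close>, since only a product of the form \<open>|u| * |w|\<close> is
  controlled by the operator norm.\<close>

lemma neg_ln_one_minus_le:
  assumes "0 \<le> x" "x < (1::real)"
  shows "- ln (1 - x) \<le> x * (1 - ln (1 - x))"
proof -
  define t where "t = - ln (1 - x)"
  have x: "x = 1 - exp (-t)" using assms by (simp add: t_def)
  have "1 + t \<le> exp t" by (rule exp_ge_add_one_self)
  then have "exp (-t) * (1 + t) \<le> 1"
    by (simp add: exp_minus field_simps)
  then have "t \<le> x * (1 + t)"
    unfolding x by (simp add: algebra_simps)
  then show ?thesis by (simp add: t_def)
qed

section \<open>Bloch norm bounds and the operator norm on test functions\<close>

lemma bloch_norm_leI:
  assumes "cmod (f 0) \<le> A" "\<And>z. z \<in> ball 0 1 \<Longrightarrow> (1 - (cmod z)\<^sup>2) * cmod (deriv f z) \<le> B"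
  shows "bloch_norm f \<le> ennreal (A + B)"
proof -
  have "0 \<le> A" using assms(1) norm_ge_zero order_trans by blast
  moreover have "0 \<le> B" using assms(2)[of 0] norm_ge_zero[of "deriv f 0"] by (simp del: norm_ge_zero)
  ultimately show ?thesis
    unfolding bloch_norm_def
    by (subst ennreal_plus) (auto intro!: add_mono SUP_least ennreal_leI assms)
qed

lemma bloch_norm_leD:
  assumes "bloch_norm f \<le> ennreal K" "z \<in> ball 0 1" "0 \<le> K"
  shows "cmod (f 0) + (1 - (cmod z)\<^sup>2) * cmod (deriv f z) \<le> K"
proof -
  have nn: "0 \<le> (1 - (cmod z)\<^sup>2) * cmod (deriv f z)"
    using assms by (auto simp: abs_square_le_1)
  have "ennreal (cmod (f 0)) + ennreal ((1 - (cmod z)\<^sup>2) * cmod (deriv f z)) \<le> bloch_norm f"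
    unfolding bloch_norm_def using assms by (intro add_left_mono SUP_upper)
  also have "\<dots> \<le> ennreal K" by fact
  finally show ?thesis
    using nn assms by (subst (asm) ennreal_plus[symmetric]) (auto simp del: ennreal_plus)
qed

lemma bloch_norm_cmult:
  assumes "f holomorphic_on ball 0 1"
  shows "bloch_norm (\<lambda>z. c * f z) = ennreal (cmod c) * bloch_norm f"
proof -
  have "deriv (\<lambda>z. c * f z) z = c * deriv f z" if "z \<in> ball 0 1" for z
    using that assms holomorphic_on_imp_differentiable_at open_ball by (intro deriv_cmult) blast
  then have "(SUP z\<in>ball 0 1. ennreal ((1 - (cmod z)\<^sup>2) * cmod (deriv (\<lambda>z. c * f z) z)))
      = (SUP z\<in>ball 0 1. ennreal (cmod c) * ennreal ((1 - (cmod z)\<^sup>2) * cmod (deriv f z)))"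
    by (intro SUP_cong refl) (auto simp: norm_mult ennreal_mult'[symmetric] mult_ac)
  then show ?thesis
    by (simp add: bloch_norm_def norm_mult ennreal_mult distrib_left SUP_mult_left_ennreal)
qed

lemma wcomp_opnorm_bloch_finite:
  assumes "wcomp_bounded_bloch u \<phi>"
  shows "wcomp_opnorm_bloch u \<phi> < \<infinity>"
proof -
  obtain M :: real where M: "\<And>f. in_bloch f \<Longrightarrow> bloch_norm (wcomp u \<phi> f) \<le> ennreal M * bloch_norm f"
    using assms unfolding wcomp_bounded_bloch_def by blast
  have "wcomp_opnorm_bloch u \<phi> \<le> ennreal M"
    unfolding wcomp_opnorm_bloch_def
  proof (rule SUP_least)
    fix f assume "f \<in> {f. in_bloch f \<and> bloch_norm f \<le> 1}"
    then show "bloch_norm (wcomp u \<phi> f) \<le> ennreal M"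
      by (metis M mem_Collect_eq mult.right_neutral mult_left_mono order_trans zero_le)
  qed
  then show ?thesis
    using ennreal_less_top infinity_ennreal_def order_le_less_trans by metis
qed

text \<open>The operator norm is a supremum over the unit ball, so \<open>f\<close> is rescaled by
  \<open>1 / K\<close>; homogeneity of the norm, applied to \<open>f\<close> and to its image,
  undoes the scaling.\<close>

lemma bloch_norm_wcomp_le:
  assumes f: "f holomorphic_on ball 0 1" "bloch_norm f \<le> ennreal K" and K: "0 < K"
    and N: "wcomp_opnorm_bloch u \<phi> = ennreal N" "0 \<le> N"
    and hol: "wcomp u \<phi> f holomorphic_on ball 0 1"
  shows "bloch_norm (wcomp u \<phi> f) \<le> ennreal (N * K)"
proof -
  define c where "c = complex_of_real (inverse K)"
  have c: "cmod c = inverse K" "0 < inverse K" using K by (auto simp: c_def norm_inverse)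
  have "bloch_norm (\<lambda>z. c * f z) \<le> ennreal (inverse K) * ennreal K"
    unfolding bloch_norm_cmult[OF f(1)] c using f(2) by (rule mult_left_mono) simp
  also have "\<dots> = 1" using K by (simp add: ennreal_mult'[symmetric])
  finally have le1: "bloch_norm (\<lambda>z. c * f z) \<le> 1" .
  moreover from le1 have "in_bloch (\<lambda>z. c * f z)"
    unfolding in_bloch_def using f(1) 
    by (auto intro!: holomorphic_intros simp: order_le_less_trans[OF _ ennreal_one_less_top])
  ultimately have "bloch_norm (wcomp u \<phi> (\<lambda>z. c * f z)) \<le> ennreal N"
    unfolding N(1)[symmetric] wcomp_opnorm_bloch_def by (intro SUP_upper) auto
  moreover have "wcomp u \<phi> (\<lambda>z. c * f z) = (\<lambda>z. c * wcomp u \<phi> f z)"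
    by (auto simp: wcomp_def)
  ultimately have "ennreal (inverse K) * bloch_norm (wcomp u \<phi> f) \<le> ennreal N"
    using bloch_norm_cmult[OF hol] c by metis
  then have "ennreal K * (ennreal (inverse K) * bloch_norm (wcomp u \<phi> f)) \<le> ennreal K * ennreal N"
    by (rule mult_left_mono) simp
  then show ?thesis
    using K N by (simp add: mult.assoc[symmetric] ennreal_mult'[symmetric] mult.commute)
qed

subsection \<open>Rotation invariance of the Lebesgue measure on the complex plane\<close>

lemma complex_box_iff:
  "z \<in> box l u \<longleftrightarrow> Re l < Re z \<and> Re z < Re u \<and> Im l < Im z \<and> Im z < Im u"
  by (auto simp: mem_box Basis_complex_def)

text \<open>Identifies the plane with \<open>real^2\<close>, so that the invariance of Lebesgue
  measure under orthogonal maps applies there. Boxes suffice to determine the measure.\<close>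

lemma lborel_complex_eq_distr_vec2:
  "distr (lborel :: (real^2) measure) borel (\<lambda>x. Complex (x $ 1) (x $ 2)) = lborel"
proof (rule lborel_eqI[symmetric])
  fix l u :: complex
  assume le: "\<And>b. b \<in> Basis \<Longrightarrow> l \<bullet> b \<le> u \<bullet> b"
  let ?T = "\<lambda>x::real^2. Complex (x $ 1) (x $ 2)"
  let ?l = "vector [Re l, Im l] :: real^2" and ?u = "vector [Re u, Im u] :: real^2"
  have le': "Re l \<le> Re u" "Im l \<le> Im u"
    using le[of 1] le[of \<i>] by (auto simp: Basis_complex_def)
  have "\<forall>i. ?l $ i \<le> ?u $ i"
    using le' by (simp add: forall_2)
  then have le'': "?l $ i \<le> ?u $ i" for i ..
  have "continuous_on UNIV ?T"
    unfolding Complex_eq by (intro continuous_intros)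
  then have meas: "?T \<in> borel_measurable lborel"
    by (simp add: borel_measurable_continuous_onI)
  have box: "?T -` box l u = box ?l ?u"
    by (auto simp: complex_box_iff mem_box_cart forall_2)
  have "emeasure (distr lborel borel ?T) (box l u) = emeasure lborel (box ?l ?u)"
    using meas by (simp add: emeasure_distr box)
  also have "\<dots> = (\<Prod>b\<in>Basis. (?u - ?l) \<bullet> b)"
    using le'' by (intro emeasure_lborel_box) (auto simp: Basis_vec_def inner_axis)
  also have "(\<Prod>b\<in>Basis. (?u - ?l) \<bullet> b) = (\<Prod>i\<in>UNIV. (?u - ?l) $ i)"
    by (simp add: Basis_vec_def cart_eq_inner_axis axis_eq_axis prod.UNION_disjoint)
  also have "\<dots> = (Re u - Re l) * (Im u - Im l)"
    by (simp add: UNIV_2)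
  also have "\<dots> = (\<Prod>b\<in>Basis. (u - l) \<bullet> b)"
    by (simp add: Basis_complex_def)
  finally show "emeasure (distr lborel borel ?T) (box l u) = (\<Prod>b\<in>Basis. (u - l) \<bullet> b)" .
qed simp

lemma lborel_complex_rotation:
  assumes c: "cmod c = 1"
  shows "distr lborel borel ((*) c) = lborel"
proof (rule lborel_eqI[symmetric])
  fix l u :: complex
  assume le: "\<And>b. b \<in> Basis \<Longrightarrow> l \<bullet> b \<le> u \<bullet> b"
  define T where "T = (\<lambda>x::real^2. Complex (x $ 1) (x $ 2))"
  define T' where "T' = (\<lambda>z. vector [Re z, Im z] :: real^2)"
  \<comment> \<open>Multiplication by \<open>cnj c\<close> inverts multiplication by
    \<open>c\<close>, so a preimage under the rotation becomes an image under the orthogonal map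
    \<open>R\<close>.\<close>
  define R where "R = (\<lambda>x. T' (cnj c * T x))"
  have inv: "T (T' z) = z" "T' (T x) = x" for z x
    by (auto simp: T_def T'_def vec_eq_iff forall_2)
  have cc: "c * cnj c = 1" "cnj c * c = 1" using c by (auto simp: complex_norm_square[symmetric] mult.commute)
  have "continuous_on UNIV T"
    unfolding T_def Complex_eq by (intro continuous_intros)
  then have measT: "T \<in> borel_measurable lborel"
    by (simp add: borel_measurable_continuous_onI)
  have meas: "(*) c \<in> borel_measurable lborel" by simp
  have setsT: "T -` A \<in> sets lborel" if "A \<in> sets borel" for A
    using measurable_sets[OF measT that] by simp
  have boxT: "T -` box l u = box (T' l) (T' u)" for l u
    by (auto simp: T_def T'_def complex_box_iff mem_box_cart forall_2)
  have lin: "linear R"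
    by (rule linearI) (auto simp: R_def T_def T'_def vec_eq_iff forall_2 algebra_simps)
  have "norm (R x) = norm x" for x
  proof -
    have n: "norm (T' z) = cmod z" for z
      by (simp add: norm_vec_def L2_set_def T'_def sum_2 cmod_def)
    have "norm x = cmod (T x)" using n[of "T x"] by (simp add: inv)
    then show ?thesis by (simp add: R_def n norm_mult c)
  qed
  with lin have orth: "orthogonal_transformation R"
    by (simp add: orthogonal_transformation)
  let ?S = "T -` box l u"
  have S: "?S \<in> lmeasurable" unfolding boxT by (rule lmeasurable_box)
  have img: "T -` ((*) c -` box l u) = R ` ?S"
  proof (intro equalityI subsetI)
    fix x assume "x \<in> T -` ((*) c -` box l u)"
    then have "T' (c * T x) \<in> ?S" by (simp add: inv)
    moreover have "x = R (T' (c * T x))"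
      using cc by (simp add: R_def inv mult.assoc[symmetric])
    ultimately show "x \<in> R ` ?S" by blast
  qed (use cc in \<open>auto simp: R_def inv mult.assoc[symmetric]\<close>)
  have pre: "(*) c -` box l u \<in> sets borel"
    using measurable_sets[OF meas, of "box l u"] by simp
  have "emeasure (distr lborel borel ((*) c)) (box l u) = emeasure lborel ((*) c -` box l u)"
    using meas by (simp add: emeasure_distr)
  also have "\<dots> = emeasure lborel (T -` ((*) c -` box l u))"
    unfolding lborel_complex_eq_distr_vec2[symmetric] T_def[symmetric]
    using measT pre by (simp add: emeasure_distr)
  also have "\<dots> = emeasure lebesgue (T -` ((*) c -` box l u))"
    using setsT[OF pre] by simp
  also have "\<dots> = emeasure lebesgue (R ` ?S)"
    unfolding img ..
  also have "\<dots> = ennreal (measure lebesgue (R ` ?S))"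
    using measurable_orthogonal_image[OF orth S] emeasure_eq_measure2 by blast
  also have "\<dots> = ennreal (measure lebesgue ?S)"
    by (simp add: measure_orthogonal_image[OF orth S])
  also have "\<dots> = emeasure lebesgue ?S"
    using S emeasure_eq_measure2 by metis
  also have "\<dots> = emeasure lborel ?S"
    using setsT[of "box l u"] by simp
  also have "\<dots> = emeasure (distr lborel borel T) (box l u)"
    using measT by (simp add: emeasure_distr)
  also have "\<dots> = emeasure lborel (box l u)"
    by (simp add: T_def lborel_complex_eq_distr_vec2)
  also have "\<dots> = (\<Prod>b\<in>Basis. (u - l) \<bullet> b)"
    using le by (rule emeasure_lborel_box)
  finally show "emeasure (distr lborel borel ((*) c)) (box l u) = (\<Prod>b\<in>Basis. (u - l) \<bullet> b)" .
qed simp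

lemma nn_integral_complex_rotation:
  assumes "cmod c = 1" "f \<in> borel_measurable borel"
  shows "(\<integral>\<^sup>+ z. f (c * z) \<partial>lborel) = (\<integral>\<^sup>+ z. f z \<partial>lborel)"
proof -
  have "(\<integral>\<^sup>+ z. f z \<partial>lborel) = (\<integral>\<^sup>+ z. f z \<partial>distr lborel borel ((*) c))"
    by (simp add: lborel_complex_rotation[OF assms(1)])
  also have "\<dots> = (\<integral>\<^sup>+ z. f (c * z) \<partial>lborel)"
    using assms(2) by (subst nn_integral_distr) auto
  finally show ?thesis ..
qed

subsection \<open>The derivative at the origin and the Bergman norm\<close>

text \<open>A geometric sum whose ratio is an \<open>n\<close>-th root of unity vanishes unless the
  ratio is 1.\<close>

lemma sum_powers_root_of_unity:
  fixes n j :: nat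
  assumes "1 \<le> n"
  defines "\<omega> \<equiv> exp (2 * of_real pi * \<i> / of_nat n) :: complex"
  shows "(\<Sum>k<n. (\<omega> ^ j) ^ k) = (if n dvd j then of_nat n else 0)"
proof -
  have "\<omega> ^ j = exp (2 * of_real pi * \<i> * of_nat j / of_nat n)"
    by (simp add: \<omega>_def exp_of_nat_mult[symmetric] mult_ac)
  then have eq1: "\<omega> ^ j = 1 \<longleftrightarrow> n dvd j"
    using complex_root_unity_eq_1[OF assms(1)] by simp
  have "\<omega> ^ n = 1"
    using assms(1) by (simp add: \<omega>_def exp_of_nat_mult[symmetric])
  then have "(\<omega> ^ j) ^ n = 1"
    by (metis mult.commute power_mult power_one)
  with eq1 show ?thesis
    by (auto simp: geometric_sum)
qed

text \<open>The exponent \<open>n - 1\<close> stands for -1 modulo \<open>n\<close>. For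
  \<open>n >= 1\<close> the average is the projection of the Taylor series onto exponents congruent
  to 1 modulo \<open>n\<close>.\<close>

definition rotation_average :: "(complex \<Rightarrow> complex) \<Rightarrow> nat \<Rightarrow> complex \<Rightarrow> complex" where
  "rotation_average g n z =
     (let \<omega> = exp (2 * of_real pi * \<i> / of_nat n)
      in (\<Sum>k<n. (\<omega> ^ (n - 1)) ^ k * g (\<omega> ^ k * z)) / of_nat n)"

text \<open>As \<open>n\<close> grows, 1 is the only fixed exponent that stays in its residue class.
  Absolute convergence of the Taylor series at \<open>z\<close> is the majorant for passing to the
  limit termwise.\<close>

lemma rotation_average_tendsto:
  assumes holg: "g holomorphic_on ball 0 1" and z: "z \<in> ball 0 1"
  shows "(\<lambda>n. rotation_average g n z) \<longlonglongrightarrow> deriv g 0 * z"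
proof -
  define a where "a m = (deriv ^^ m) g 0 / fact m" for m
  have sums_g: "(\<lambda>m. a m * w ^ m) sums g w" if "w \<in> ball 0 1" for w
    using holomorphic_power_series[OF holg that] by (simp add: a_def)
  \<comment> \<open>A point of the disk of larger modulus than \<open>z\<close>: convergence of the
    power series at \<open>x\<close> gives absolute convergence at \<open>z\<close>.\<close>
  define x where "x = complex_of_real ((1 + cmod z) / 2)"
  have "cmod x = (1 + cmod z) / 2"
    unfolding x_def norm_of_real by simp
  then have "x \<in> ball 0 1" "cmod z < cmod x"
    using z by auto
  then have summ: "summable (\<lambda>m. cmod (a m * z ^ m))"
    using powser_insidea sums_summable[OF sums_g] by blast
  define e :: "nat \<Rightarrow> nat \<Rightarrow> complex" where "e n m = (if n dvd n - 1 + m then 1 else 0)" for n m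
  have avg: "rotation_average g n z = (\<Sum>m. a m * z ^ m * e n m)" if n: "1 \<le> n" for n
  proof -
    define \<omega> :: complex where "\<omega> = exp (2 * of_real pi * \<i> / of_nat n)"
    have norm\<omega>: "cmod \<omega> = 1"
      unfolding \<omega>_def by (simp add: Re_divide_of_nat)
    have in_disk: "\<omega> ^ k * z \<in> ball 0 1" for k
      using z by (simp add: norm_mult norm_power norm\<omega>)
    have "(\<lambda>m. \<Sum>k<n. (\<omega> ^ (n - 1)) ^ k * (a m * (\<omega> ^ k * z) ^ m)) sums
          (\<Sum>k<n. (\<omega> ^ (n - 1)) ^ k * g (\<omega> ^ k * z))"
      by (intro sums_sum sums_mult sums_g in_disk)
    moreover have "(\<Sum>k<n. (\<omega> ^ (n - 1)) ^ k * (a m * (\<omega> ^ k * z) ^ m))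
                   = a m * z ^ m * e n m * of_nat n" for m
    proof -
      have "(\<omega> ^ k) ^ m = (\<omega> ^ m) ^ k" for k
        by (metis mult.commute power_mult)
      then have "(\<omega> ^ p) ^ k * (a m * (\<omega> ^ k * z) ^ m) = a m * z ^ m * (\<omega> ^ (p + m)) ^ k" for p k
        by (simp add: power_add power_mult_distrib mult_ac)
      then have "(\<Sum>k<n. (\<omega> ^ (n - 1)) ^ k * (a m * (\<omega> ^ k * z) ^ m))
            = a m * z ^ m * (\<Sum>k<n. (\<omega> ^ (n - 1 + m)) ^ k)"
        unfolding sum_distrib_left by (intro sum.cong refl)
      then show ?thesis
        unfolding \<omega>_def sum_powers_root_of_unity[OF n] e_def by simp
    qed
    ultimately have "(\<lambda>m. a m * z ^ m * e n m * of_nat n) sums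
          (\<Sum>k<n. (\<omega> ^ (n - 1)) ^ k * g (\<omega> ^ k * z))"
      by simp
    from sums_divide[OF this, of "of_nat n"] 
    have "(\<lambda>m. a m * z ^ m * e n m) sums rotation_average g n z"
      using n by (simp add: rotation_average_def \<omega>_def[symmetric])
    then show ?thesis by (simp add: sums_iff)
  qed
  have e_lim: "(\<lambda>n. e n m) \<longlonglongrightarrow> (if m = 1 then 1 else 0)" for m
  proof -
    \<comment> \<open>From \<open>n = m + 2\<close> on, divisibility would force \<open>n\<close> to
      divide \<open>n - 1\<close> (if \<open>m = 0\<close>) or \<open>m - 1\<close> (if
      \<open>m >= 2\<close>), both positive and below \<open>n\<close>.\<close>
    have "e n m = (if m = 1 then 1 else 0)" if n: "n \<ge> m + 2" for n
    proof -
      have "n dvd n - 1 + m \<longleftrightarrow> m = 1"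
      proof
        assume d: "n dvd n - 1 + m"
        consider "m = 0" | "m = 1" | "m \<ge> 2" by linarith
        then show "m = 1"
        proof cases
          assume "m = 0"
          then show ?thesis using d n by (auto dest: dvd_imp_le)
        next
          assume m: "m \<ge> 2"
          have "n - 1 + m = n + (m - 1)" using m n by simp
          then have "n dvd m - 1" using d by simp
          then show ?thesis using m n by (auto dest: dvd_imp_le)
        qed
      qed (use n in auto)
      then show ?thesis by (simp add: e_def)
    qed
    then have "eventually (\<lambda>n. (if m = 1 then 1 else 0) = e n m) sequentially"
      unfolding eventually_sequentially by metis
    then show ?thesis
      by (rule Lim_transform_eventually[OF tendsto_const])
  qed
  have lim: "(\<lambda>n. a m * z ^ m * e n m) \<longlonglongrightarrow> a m * z ^ m * (if m = 1 then 1 else 0)" for m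
    by (intro tendsto_mult tendsto_const e_lim)
  have "(\<lambda>n. \<Sum>m. a m * z ^ m * e n m) \<longlonglongrightarrow> (\<Sum>m. a m * z ^ m * (if m = 1 then 1 else 0))"
  proof (rule tannerys_theorem[OF lim _ summ sequentially_bot, THEN conjunct2, THEN conjunct2])
    show "\<forall>\<^sub>F (m, n) in sequentially \<times>\<^sub>F sequentially. cmod (a m * z ^ m * e n m) \<le> cmod (a m * z ^ m)"
      by (rule always_eventually) (auto simp: e_def norm_mult)
  qed
  moreover have "(\<lambda>m. a m * z ^ m * (if m = 1 then 1 else 0)) sums (a 1 * z ^ 1)"
    using sums_single[of 1 "\<lambda>m. a m * z ^ m"] by (simp add: if_distrib cong: if_cong)
  ultimately have "(\<lambda>n. \<Sum>m. a m * z ^ m * e n m) \<longlonglongrightarrow> deriv g 0 * z"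
    by (simp add: sums_iff a_def)
  moreover have "eventually (\<lambda>n. (\<Sum>m. a m * z ^ m * e n m) = rotation_average g n z) sequentially"
    using eventually_ge_at_top[of 1] by eventually_elim (simp add: avg)
  ultimately show ?thesis by (rule Lim_transform_eventually)
qed

text \<open>The weights are unimodular, so the triangle inequality and Cauchy-Schwarz apply.\<close>

lemma rotation_average_square_le:
  assumes "1 \<le> n"
  shows "(cmod (rotation_average g n z))\<^sup>2
         \<le> (\<Sum>k<n. (cmod (g (exp (2 * of_real pi * \<i> / of_nat n) ^ k * z)))\<^sup>2) / n"
proof -
  define \<omega> :: complex where "\<omega> = exp (2 * of_real pi * \<i> / of_nat n)"
  have norm\<omega>: "cmod \<omega> = 1"
    unfolding \<omega>_def by (simp add: Re_divide_of_nat)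
  have "cmod (rotation_average g n z) \<le> (\<Sum>k<n. cmod (g (\<omega> ^ k * z))) / n"
    unfolding rotation_average_def Let_def \<omega>_def[symmetric] norm_divide norm_of_nat
    by (intro divide_right_mono order_trans[OF norm_sum] sum_mono)
       (simp_all add: norm_mult norm_power norm\<omega>)
  then have "(cmod (rotation_average g n z))\<^sup>2 \<le> ((\<Sum>k<n. cmod (g (\<omega> ^ k * z))) / n)\<^sup>2"
    by (rule power_mono) simp
  also have "\<dots> \<le> ((\<Sum>k<n. (cmod (g (\<omega> ^ k * z)))\<^sup>2) * n) / (real n)\<^sup>2"
    unfolding power_divide using sum_squared_le_sum_of_squares[of "\<lambda>k. cmod (g (\<omega> ^ k * z))" "{..<n}"]
    by (intro divide_right_mono) auto
  also have "\<dots> = (\<Sum>k<n. (cmod (g (\<omega> ^ k * z)))\<^sup>2) / n"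
    using assms by (simp add: power2_eq_square)
  finally show ?thesis unfolding \<omega>_def .
qed

text \<open>Rotation averages pick out the linear Taylor term in the limit and do not increase the
  integral of the square; Fatou's lemma concludes without polar coordinates.\<close>
lemma deriv_le_square_integral:
  assumes holg: "g holomorphic_on ball 0 1"
  shows "(\<integral>\<^sup>+ z. ennreal ((cmod (deriv g 0 * z))\<^sup>2) * indicator (ball 0 1) z \<partial>lborel)
         \<le> (\<integral>\<^sup>+ z. ennreal ((cmod (g z))\<^sup>2) * indicator (ball 0 1) z \<partial>lborel)" (is "_ \<le> ?I")
proof -
  \<comment> \<open>\<open>g\<close> is continuous only on the disk; cutting off with the real
    indicator gives Borel measurability on the whole plane.\<close>
  define h where "h z = ennreal (indicator (ball 0 1) z *\<^sub>R (cmod (g z))\<^sup>2)" for z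
  have contg: "continuous_on (ball 0 1) g"
    using holg holomorphic_on_imp_continuous_on by blast
  have h_meas [measurable]: "h \<in> borel_measurable borel"
    unfolding h_def[abs_def]
    by (intro measurable_compose[OF _ measurable_ennreal] borel_measurable_continuous_on_indicator
        continuous_intros contg) auto
  have h_eq: "h z = ennreal ((cmod (g z))\<^sup>2) * indicator (ball 0 1) z" for z
    by (simp add: h_def indicator_def)
  define \<omega> :: "nat \<Rightarrow> complex" where "\<omega> n = exp (2 * of_real pi * \<i> / of_nat n)" for n
  have norm\<omega>: "cmod (\<omega> n ^ k) = 1" for n k
    unfolding \<omega>_def norm_power by (simp add: Re_divide_of_nat)
  define H where "H n z = (\<Sum>k<n. h (\<omega> n ^ k * z)) / of_nat n" for n z
  have H_meas [measurable]: "H n \<in> borel_measurable lborel" for n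
    unfolding H_def[abs_def] by measurable
  have int_H: "(\<integral>\<^sup>+ z. H n z \<partial>lborel) = ?I" if "1 \<le> n" for n
  proof -
    have "(\<integral>\<^sup>+ z. H n z \<partial>lborel) = (\<Sum>k<n. \<integral>\<^sup>+ z. h (\<omega> n ^ k * z) \<partial>lborel) / of_nat n"
      unfolding H_def by (subst nn_integral_divide, measurable) (subst nn_integral_sum, measurable)
    also have "\<dots> = of_nat n * (\<integral>\<^sup>+ z. h z \<partial>lborel) / of_nat n"
      by (simp add: nn_integral_complex_rotation[OF norm\<omega> h_meas])
    also have "\<dots> = of_nat n * ?I / of_nat n"
      by (simp add: h_eq)
    also have "\<dots> = ?I"
      using that by (subst mult.commute, subst mult_divide_eq_ennreal) auto
    finally show ?thesis .
  qed
  have le_liminf: "ennreal ((cmod (deriv g 0 * z))\<^sup>2) * indicator (ball 0 1) z \<le> liminf (\<lambda>n. H n z)" for z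
  proof (cases "z \<in> ball 0 1")
    case True
    have "(\<lambda>n. ennreal ((cmod (rotation_average g n z))\<^sup>2)) \<longlonglongrightarrow> ennreal ((cmod (deriv g 0 * z))\<^sup>2)"
      by (intro tendsto_ennrealI tendsto_power tendsto_norm rotation_average_tendsto holg True)
    then have "ennreal ((cmod (deriv g 0 * z))\<^sup>2) = liminf (\<lambda>n. ennreal ((cmod (rotation_average g n z))\<^sup>2))"
      by (intro lim_imp_Liminf[symmetric]) auto
    also have "\<dots> \<le> liminf (\<lambda>n. H n z)"
    proof (intro Liminf_mono)
      have "ennreal ((cmod (rotation_average g n z))\<^sup>2) \<le> H n z" if n: "1 \<le> n" for n
      proof -
        have "h (\<omega> n ^ k * z) = ennreal ((cmod (g (\<omega> n ^ k * z)))\<^sup>2)" for k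
          using True norm\<omega>[of n k] unfolding h_eq by (simp add: norm_mult)
        then have "H n z = ennreal ((\<Sum>k<n. (cmod (g (\<omega> n ^ k * z)))\<^sup>2) / n)"
          using n by (simp add: H_def sum_ennreal divide_ennreal[symmetric] ennreal_of_nat_eq_real_of_nat sum_nonneg)
        then show ?thesis
          using rotation_average_square_le[OF n, of g z] by (simp add: \<omega>_def ennreal_leI)
      qed
      then show "\<forall>\<^sub>F n in sequentially. ennreal ((cmod (rotation_average g n z))\<^sup>2) \<le> H n z"
        unfolding eventually_sequentially by blast
    qed
    finally show ?thesis using True by simp
  qed simp
  have "(\<integral>\<^sup>+ z. ennreal ((cmod (deriv g 0 * z))\<^sup>2) * indicator (ball 0 1) z \<partial>lborel)
        \<le> (\<integral>\<^sup>+ z. liminf (\<lambda>n. H n z) \<partial>lborel)"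
    by (intro nn_integral_mono le_liminf)
  also have "\<dots> \<le> liminf (\<lambda>n. \<integral>\<^sup>+ z. H n z \<partial>lborel)"
    by (rule nn_integral_liminf) measurable
  also have "\<dots> = liminf (\<lambda>n. ?I)"
    by (rule Liminf_eq) (use int_H in \<open>auto simp: eventually_sequentially\<close>)
  also have "\<dots> = ?I" by (simp add: Liminf_const)
  finally show ?thesis .
qed

lemma emeasure_disk_annulus:
  assumes "0 \<le> r" "r \<le> 1"
  shows "emeasure lborel (ball 0 1 - ball 0 r :: complex set) = ennreal (pi * (1 - r\<^sup>2))"
proof -
  have "emeasure lborel (ball 0 1 - ball 0 r :: complex set)
        = emeasure lborel (ball 0 1 :: complex set) - emeasure lborel (ball 0 r :: complex set)"
    using assms by (intro emeasure_Diff) (auto simp: emeasure_ball subset_ball)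
  also have "\<dots> = ennreal (pi * (1 - r\<^sup>2))"
    using assms by (simp add: emeasure_ball unit_ball_vol_2 ennreal_minus algebra_simps)
  finally show ?thesis .
qed

text \<open>The integral of \<open>|g'(0) * z|^2\<close> is bounded below on the annulus
  \<open>1/2 <= |z| < 1\<close>, of area \<open>3 * pi / 4\<close>, where the integrand is at least
  \<open>|g'(0)|^2 / 4\<close>. This gives the factor 16/3, rounded up to 9 for a rational square
  root.\<close>

lemma deriv_le_A2_norm:
  assumes holg: "g holomorphic_on ball 0 1"
  shows "ennreal (cmod (deriv g 0)) \<le> ennreal 3 * A2_norm g"
proof -
  define I where "I = (\<integral>\<^sup>+ z. ennreal ((cmod (g z))\<^sup>2) * indicator (ball 0 1) z \<partial>lborel)"
  define d where "d = cmod (deriv g 0)"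
  show ?thesis
  proof (cases "I = \<infinity>")
    case True
    then show ?thesis by (simp add: A2_norm_def I_def[symmetric] ennreal_mult_top)
  next
    case False
    then obtain J where J: "I = ennreal J" "0 \<le> J"
      by (metis ennreal_cases infinity_ennreal_def)
    have "ennreal (d\<^sup>2 / 4) * emeasure lborel (ball 0 1 - ball 0 (1/2) :: complex set)
          = (\<integral>\<^sup>+ z. ennreal (d\<^sup>2 / 4) * indicator (ball 0 1 - ball 0 (1/2) :: complex set) z \<partial>lborel)"
      by (subst nn_integral_cmult_indicator) auto
    also have "\<dots> \<le> (\<integral>\<^sup>+ z. ennreal ((cmod (deriv g 0 * z))\<^sup>2) * indicator (ball 0 1) z \<partial>lborel)"
    proof (intro nn_integral_mono)
      fix z :: complex
      have "d\<^sup>2 / 4 \<le> (cmod (deriv g 0 * z))\<^sup>2" if "1/2 \<le> cmod z"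
      proof -
        have "(d * (1/2))\<^sup>2 \<le> (d * cmod z)\<^sup>2"
          using that by (intro power_mono mult_left_mono) (auto simp: d_def)
        then show ?thesis by (simp add: d_def norm_mult power_divide)
      qed
      then show "ennreal (d\<^sup>2 / 4) * indicator (ball 0 1 - ball 0 (1/2)) z
            \<le> ennreal ((cmod (deriv g 0 * z))\<^sup>2) * indicator (ball 0 1) z"
        by (auto simp: indicator_def intro!: ennreal_leI)
    qed
    also have "\<dots> \<le> ennreal J"
      using deriv_le_square_integral[OF holg] by (simp add: I_def[symmetric] J)
    finally have "d\<^sup>2 / 4 * (pi * (1 - (1/2)\<^sup>2)) \<le> J"
      using J by (subst (asm) emeasure_disk_annulus) (auto simp: ennreal_mult'[symmetric])
    then have "d\<^sup>2 * 3 \<le> 16 * (J / pi)"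
      by (simp add: field_simps power2_eq_square)
    moreover have "0 \<le> J / pi" using J by simp
    ultimately have "d\<^sup>2 \<le> 9 * (J / pi)" by linarith
    then have "d \<le> sqrt (9 * (J / pi))" by (rule real_le_rsqrt)
    also have "\<dots> = 3 * sqrt (J / pi)" unfolding real_sqrt_mult by simp
    finally have "ennreal d \<le> ennreal 3 * ennreal (sqrt (J / pi))"
      by (subst ennreal_mult'[symmetric]) (auto intro: ennreal_leI)
    then show ?thesis using False J
      by (simp add: A2_norm_def I_def[symmetric] d_def)
  qed
qed

subsection \<open>Bergman norm of functions of logarithmic growth\<close>

text \<open>The weight is \<open>(1 - |z|) powr (-1/2)\<close>; the disk is cut into the sets where
  \<open>- ln (1 - |z|)\<close> has a given integer part.\<close>
lemma nn_integral_disk_weight_finite: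
  obtains K :: real where "K > 0"
    "(\<integral>\<^sup>+ z. ennreal (exp (- ln (1 - cmod z) / 2)) * indicator (ball 0 1) z \<partial>lborel) \<le> ennreal K"
proof -
  define c :: "nat \<Rightarrow> real" where "c k = exp ((real k + 1) / 2)" for k
  \<comment> \<open>The sets \<open>A k\<close> are nested and contain the layers
    \<open>k <= l < k + 1\<close> of \<open>l = - ln (1 - |z|)\<close>, on which the weight is at
    most \<open>c k\<close>. Overcounting is harmless: the area of \<open>A k\<close> is at most
    \<open>2 * pi * exp (- k)\<close>, so the products are dominated by the geometric sequence
    \<open>s\<close>.\<close>
  define A :: "nat \<Rightarrow> complex set" where "A k = ball 0 1 - ball 0 (1 - exp (- real k))" for k
  define s :: "nat \<Rightarrow> real" where "s k = 2 * pi * exp (1/2) * exp (-1/2) ^ k" for k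
  have [measurable]: "A k \<in> sets borel" for k
    unfolding A_def by auto
  have "norm (exp (-1/2 :: real)) < 1" by simp
  then have "summable s"
    unfolding s_def[abs_def] by (intro summable_mult summable_geometric)
  have s_pos: "0 < s k" for k by (simp add: s_def)
  have A_le: "ennreal (c k) * emeasure lborel (A k) \<le> ennreal (s k)" for k
  proof -
    let ?e = "exp (- real k)"
    have "1 - (1 - ?e)\<^sup>2 \<le> 2 * ?e"
      by (simp add: power2_eq_square algebra_simps)
    then have "c k * (pi * (1 - (1 - ?e)\<^sup>2)) \<le> c k * (pi * (2 * ?e))"
      by (intro mult_left_mono) (auto simp: c_def)
    also have "\<dots> = s k"
      by (simp add: c_def s_def exp_of_nat_mult[symmetric] exp_add[symmetric] field_simps)
    finally show ?thesis
      by (simp add: A_def emeasure_disk_annulus c_def ennreal_mult'[symmetric] ennreal_leI)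
  qed
  have "(\<integral>\<^sup>+ z. ennreal (exp (- ln (1 - cmod z) / 2)) * indicator (ball 0 1) z \<partial>lborel)
        \<le> (\<integral>\<^sup>+ z. (\<Sum>k. ennreal (c k) * indicator (A k) z) \<partial>lborel)"
  proof (intro nn_integral_mono)
    fix z :: complex
    show "ennreal (exp (- ln (1 - cmod z) / 2)) * indicator (ball 0 1) z
          \<le> (\<Sum>k. ennreal (c k) * indicator (A k) z)"
    proof (cases "z \<in> ball 0 1")
      case True
      define l where "l = - ln (1 - cmod z)"
      define k where "k = nat \<lfloor>l\<rfloor>"
      have l: "0 \<le> l" "exp (- l) = 1 - cmod z"
        using True by (auto simp: l_def)
      have k: "real k \<le> l" "l \<le> real k + 1"
        using l(1) unfolding k_def by linarith+
      have "exp (- l) \<le> exp (- real k)" using k by simp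
      then have "z \<in> A k" using True l by (simp add: A_def)
      then have "ennreal (exp (l / 2)) \<le> ennreal (c k) * indicator (A k) z"
        using k by (simp add: c_def ennreal_leI)
      also have "\<dots> \<le> (\<Sum>k. ennreal (c k) * indicator (A k) z)"
        using sum_le_suminf[OF summableI, of "{k}" "\<lambda>k. ennreal (c k) * indicator (A k) z"]
        by (simp del: sum_mult_indicator)
      finally show ?thesis using True by (simp add: l_def)
    qed simp
  qed
  also have "\<dots> = (\<Sum>k. ennreal (c k) * emeasure lborel (A k))"
    by (subst nn_integral_suminf) (auto simp: nn_integral_cmult_indicator)
  also have "\<dots> \<le> (\<Sum>k. ennreal (s k))"
    by (intro suminf_le A_le) auto
  also have "\<dots> = ennreal (\<Sum>k. s k)"
    using s_pos \<open>summable s\<close> by (intro suminf_ennreal2) (auto intro: less_imp_le)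
  finally show ?thesis
    using that[of "\<Sum>k. s k"] suminf_pos[OF \<open>summable s\<close> s_pos] by blast
qed

text \<open>With \<open>X = exp (l / 8)\<close> one has \<open>l <= 8 * X\<close> and
  \<open>X <= X^2\<close>, hence the constant \<open>7 * 8 + 4 * 64 = 312\<close>; then
  \<open>X^4 = exp (l / 2)\<close>.\<close>

lemma log_polynomial_square_le_weight:
  fixes l :: real
  assumes "0 \<le> l"
  shows "(7 * l + 4 * l\<^sup>2)\<^sup>2 \<le> 312\<^sup>2 * exp (l / 2)"
proof -
  define X where "X = exp (l / 8)"
  have "1 \<le> X" using assms by (simp add: X_def)
  have "1 + l / 8 \<le> X" unfolding X_def by (rule exp_ge_add_one_self)
  then have lX: "l \<le> 8 * X" by simp
  have "l\<^sup>2 \<le> (8 * X)\<^sup>2" by (intro power_mono lX assms)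
  moreover have "X \<le> X\<^sup>2" using \<open>1 \<le> X\<close> by (simp add: power2_eq_square)
  ultimately have "7 * l + 4 * l\<^sup>2 \<le> 312 * X\<^sup>2"
    using lX by (simp add: power_mult_distrib)
  then have "(7 * l + 4 * l\<^sup>2)\<^sup>2 \<le> (312 * X\<^sup>2)\<^sup>2"
    using assms by (intro power_mono) auto
  also have "\<dots> = 312\<^sup>2 * X ^ 4" by (simp add: power_mult_distrib)
  also have "X ^ 4 = exp (l / 2)" by (simp add: X_def exp_of_nat_mult[symmetric])
  finally show ?thesis .
qed

text \<open>\<open>D\<close> depends only on the integral of the weight, hence is uniform in
  \<open>g\<close> and \<open>B\<close>. The polynomial is the one produced by the pointwise lower
  bound for the operator norm.\<close>

lemma A2_norm_log_polynomial_bound: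
  obtains D :: real where "D > 0"
    "\<And>g B. 0 \<le> B \<Longrightarrow>
       (\<And>z. z \<in> ball 0 1 \<Longrightarrow> cmod (g z) \<le> B * (7 * (- ln (1 - cmod z)) + 4 * (- ln (1 - cmod z))\<^sup>2)) \<Longrightarrow>
       A2_norm g \<le> ennreal (D * B)"
proof -
  obtain K :: real where K: "K > 0"
    "(\<integral>\<^sup>+ z. ennreal (exp (- ln (1 - cmod z) / 2)) * indicator (ball 0 1) z \<partial>lborel) \<le> ennreal K"
    using nn_integral_disk_weight_finite by blast
  define D where "D = 312 * sqrt (K / pi)"
  have "A2_norm g \<le> ennreal (D * B)"
    if B: "0 \<le> B" and g: "\<And>z. z \<in> ball 0 1 \<Longrightarrow>
        cmod (g z) \<le> B * (7 * (- ln (1 - cmod z)) + 4 * (- ln (1 - cmod z))\<^sup>2)" for g B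
  proof -
    define I where "I = (\<integral>\<^sup>+ z. ennreal ((cmod (g z))\<^sup>2) * indicator (ball 0 1) z \<partial>lborel)"
    have "I \<le> (\<integral>\<^sup>+ z. ennreal ((312 * B)\<^sup>2) *
            (ennreal (exp (- ln (1 - cmod z) / 2)) * indicator (ball 0 1) z) \<partial>lborel)"
      unfolding I_def
    proof (intro nn_integral_mono)
      fix z :: complex
      have "(cmod (g z))\<^sup>2 \<le> (312 * B)\<^sup>2 * exp (- ln (1 - cmod z) / 2)" if z: "z \<in> ball 0 1"
      proof -
        have "0 \<le> - ln (1 - cmod z)" using z by simp
        note le = log_polynomial_square_le_weight[OF this]
        have "(cmod (g z))\<^sup>2 \<le> (B * (7 * (- ln (1 - cmod z)) + 4 * (- ln (1 - cmod z))\<^sup>2))\<^sup>2"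
          by (intro power_mono g z norm_ge_zero)
        also have "\<dots> \<le> B\<^sup>2 * (312\<^sup>2 * exp (- ln (1 - cmod z) / 2))"
          unfolding power_mult_distrib[of B] by (intro mult_left_mono le) simp
        finally show ?thesis by (simp add: power_mult_distrib mult_ac)
      qed
      then show "ennreal ((cmod (g z))\<^sup>2) * indicator (ball 0 1) z \<le> ennreal ((312 * B)\<^sup>2) *
            (ennreal (exp (- ln (1 - cmod z) / 2)) * indicator (ball 0 1) z)"
        by (auto simp: indicator_def ennreal_mult'[symmetric] intro!: ennreal_leI)
    qed
    also have "\<dots> = ennreal ((312 * B)\<^sup>2) *
        (\<integral>\<^sup>+ z. ennreal (exp (- ln (1 - cmod z) / 2)) * indicator (ball 0 1) z \<partial>lborel)"
      by (intro nn_integral_cmult borel_measurable_times_ennreal borel_measurable_indicator) auto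
    also have "\<dots> \<le> ennreal ((312 * B)\<^sup>2) * ennreal K"
      by (intro mult_left_mono K) simp
    also have "\<dots> = ennreal ((312 * B)\<^sup>2 * K)" by (simp add: ennreal_mult')
    finally have I_le: "I \<le> ennreal ((312 * B)\<^sup>2 * K)" .
    then have "I \<noteq> \<infinity>" by (metis ennreal_neq_top infinity_ennreal_def top.extremum_unique)
    moreover have "enn2real I \<le> (312 * B)\<^sup>2 * K"
      using I_le K by (intro enn2real_leI) auto
    then have "sqrt (enn2real I / pi) \<le> sqrt ((312 * B)\<^sup>2 * K / pi)"
      by (intro real_sqrt_le_mono divide_right_mono) auto
    moreover have "sqrt ((312 * B)\<^sup>2 * K / pi) = D * B"
      using B by (simp add: D_def real_sqrt_mult real_sqrt_divide)
    moreover have "A2_norm g = ennreal (sqrt (enn2real I / pi))"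
      using \<open>I \<noteq> \<infinity>\<close> by (simp add: A2_norm_def I_def[symmetric])
    ultimately show ?thesis
      by (metis ennreal_leI)
  qed
  then show ?thesis using that[of D] K by (simp add: D_def)
qed

subsection \<open>Lower bounds for the operator norm\<close>

definition bloch_log :: "complex \<Rightarrow> complex \<Rightarrow> complex" where
  "bloch_log b w = complex_of_real (ln 2) - Ln (1 - cnj b * w)"

lemma bloch_log_DERIV:
  assumes "b \<in> ball 0 1" "w \<in> ball 0 1"
  shows "(bloch_log b has_field_derivative cnj b / (1 - cnj b * w)) (at w)"
proof -
  have "cmod (cnj b * w) < 1 * 1"
    unfolding norm_mult using assms by (intro mult_strict_mono') auto
  then have "Re (cnj b * w) < 1"
    using complex_Re_le_cmod[of "cnj b * w"] by linarith
  then have "1 - cnj b * w \<notin> \<real>\<^sub>\<le>\<^sub>0"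
    by (auto simp: complex_nonpos_Reals_iff)
  then show ?thesis
    unfolding bloch_log_def[abs_def] by (auto intro!: derivative_eq_intros simp: divide_inverse mult.commute)
qed

lemma bloch_log_holomorphic: "b \<in> ball 0 1 \<Longrightarrow> bloch_log b holomorphic_on ball 0 1"
  using bloch_log_DERIV holomorphic_on_open open_ball by blast

text \<open>From \<open>|1 - cnj b * w| >= 1 - |w|\<close> and
  \<open>1 - |w|^2 <= 2 * (1 - |w|)\<close>; the bound is uniform in \<open>b\<close>.\<close>

lemma bloch_log_deriv_le:
  assumes "b \<in> ball 0 1" "w \<in> ball 0 1"
  shows "(1 - (cmod w)\<^sup>2) * cmod (deriv (bloch_log b) w) \<le> 2"
proof -
  have b: "cmod b < 1" and w: "cmod w < 1" using assms by auto
  have "cmod b * cmod w \<le> 1 * cmod w" using b by (intro mult_right_mono) auto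
  then have "1 - cmod w \<le> 1 - cmod (cnj b * w)" by (simp add: norm_mult)
  also have "\<dots> \<le> cmod (1 - cnj b * w)"
    using norm_triangle_ineq2[of 1 "cnj b * w"] by simp
  finally have le: "1 - cmod w \<le> cmod (1 - cnj b * w)" .
  then have X: "0 < cmod (1 - cnj b * w)" using w by linarith
  have "(1 - (cmod w)\<^sup>2) * cmod b \<le> (1 - (cmod w)\<^sup>2) * 1"
    using b w by (intro mult_left_mono) (auto simp: abs_square_le_1)
  also have "\<dots> = (1 + cmod w) * (1 - cmod w)" by (simp add: power2_eq_square algebra_simps)
  also have "\<dots> \<le> 2 * cmod (1 - cnj b * w)"
    using w le by (intro mult_mono) auto
  finally have "(1 - (cmod w)\<^sup>2) * cmod b \<le> 2 * cmod (1 - cnj b * w)" .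
  then show ?thesis
    unfolding DERIV_imp_deriv[OF bloch_log_DERIV[OF assms]]
    using X by (simp only: norm_divide complex_mod_cnj times_divide_eq_right pos_divide_le_eq)
qed

lemma bloch_log_0 [simp]: "bloch_log b 0 = complex_of_real (ln 2)"
  by (simp add: bloch_log_def)

lemma bloch_log_self:
  assumes "b \<in> ball 0 1"
  shows "bloch_log b b = complex_of_real (ln (2 / (1 - (cmod b)\<^sup>2)))"
proof -
  have "0 < 1 - (cmod b)\<^sup>2" using assms by (simp add: abs_square_less_1)
  moreover have "1 - cnj b * b = complex_of_real (1 - (cmod b)\<^sup>2)"
    by (simp add: complex_norm_square[symmetric] mult.commute)
  ultimately have "Ln (1 - cnj b * b) = complex_of_real (ln (1 - (cmod b)\<^sup>2))"
    by (simp only: Ln_of_real)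
  then show ?thesis
    using \<open>0 < 1 - (cmod b)\<^sup>2\<close> by (simp add: bloch_log_def ln_div)
qed

text \<open>Each of the \<open>n\<close> terms \<open>r^k\<close> with \<open>k < n\<close> is at
  least \<open>r^(n-1)\<close>, so the geometric sum gives
  \<open>n * r^(n-1) * (1 - r) <= 1 - r^n\<close>, uniformly in \<open>n\<close>.\<close>

lemma power_deriv_le:
  assumes "w \<in> ball 0 1"
  shows "(1 - (cmod w)\<^sup>2) * cmod (deriv (\<lambda>w. w ^ n) w) \<le> 2"
proof -
  define r where "r = cmod w"
  have r: "0 \<le> r" "r < 1" using assms by (auto simp: r_def)
  have "deriv (\<lambda>w. w ^ n) w = of_nat n * w ^ (n - 1)"
    by (rule DERIV_imp_deriv) (auto intro!: derivative_eq_intros)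
  then have d: "cmod (deriv (\<lambda>w. w ^ n) w) = real n * r ^ (n - 1)"
    by (simp add: r_def norm_mult norm_power)
  have "real n * r ^ (n - 1) = (\<Sum>k<n. r ^ (n - 1))" by simp
  also have "\<dots> \<le> (\<Sum>k<n. r ^ k)"
    using r by (intro sum_mono power_decreasing) auto
  finally have "(1 - r) * (real n * r ^ (n - 1)) \<le> (1 - r) * (\<Sum>k<n. r ^ k)"
    using r by (intro mult_left_mono) auto
  also have "\<dots> = 1 - r ^ n" using r by (simp add: sum_gp_strict)
  also have "\<dots> \<le> 1" using r by simp
  finally have le: "(1 - r) * (real n * r ^ (n - 1)) \<le> 1" .
  have "(1 - r\<^sup>2) * (real n * r ^ (n - 1)) = (1 + r) * ((1 - r) * (real n * r ^ (n - 1)))"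
    by (simp add: power2_eq_square algebra_simps)
  also have "\<dots> \<le> 2 * 1" using r le by (intro mult_mono) auto
  finally show ?thesis by (simp add: d r_def[symmetric])
qed

lemma deriv_wcomp:
  assumes "u holomorphic_on ball 0 1" "self_map_disk \<phi>" "f holomorphic_on ball 0 1" "z \<in> ball 0 1"
  shows "deriv (wcomp u \<phi> f) z = deriv u z * f (\<phi> z) + u z * (deriv f (\<phi> z) * deriv \<phi> z)"
proof -
  have \<phi>: "\<phi> holomorphic_on ball 0 1" "\<phi> z \<in> ball 0 1"
    using assms(2,4) unfolding self_map_disk_def by blast+
  have "(u has_field_derivative deriv u z) (at z)" "(\<phi> has_field_derivative deriv \<phi> z) (at z)"
    "(f has_field_derivative deriv f (\<phi> z)) (at (\<phi> z))"
    using assms \<phi> holomorphic_derivI open_ball by blast+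
  then show ?thesis
    unfolding wcomp_def
    by (intro DERIV_imp_deriv) (auto intro!: derivative_eq_intros DERIV_chain2[of f])
qed

lemma wcomp_holomorphic:
  assumes "u holomorphic_on ball 0 1" "self_map_disk \<phi>" "f holomorphic_on ball 0 1"
  shows "wcomp u \<phi> f holomorphic_on ball 0 1"
proof -
  have "(f \<circ> \<phi>) holomorphic_on ball 0 1"
    using assms by (auto simp: self_map_disk_def intro: holomorphic_on_compose_gen)
  then show ?thesis
    using assms(1) unfolding wcomp_def o_def by (intro holomorphic_intros)
qed

lemma bloch_norm_wcomp_test:
  assumes "u holomorphic_on ball 0 1" "self_map_disk \<phi>" "f holomorphic_on ball 0 1"
    and N: "wcomp_opnorm_bloch u \<phi> = ennreal N" "0 \<le> N"
    and "cmod (f 0) \<le> A" "\<And>z. z \<in> ball 0 1 \<Longrightarrow> (1 - (cmod z)\<^sup>2) * cmod (deriv f z) \<le> B"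
    and "0 < A + B"
  shows "bloch_norm (wcomp u \<phi> f) \<le> ennreal (N * (A + B))"
  using assms by (intro bloch_norm_wcomp_le[OF _ bloch_norm_leI] wcomp_holomorphic)

text \<open>Keeps the logarithmic weight away from 0, so that it may absorb constants and be divided
  by.\<close>

lemma ln_two_div_ge_half:
  assumes "w \<in> ball 0 1"
  shows "1 / 2 \<le> ln (2 / (1 - (cmod w)\<^sup>2))"
proof -
  have "(cmod w)\<^sup>2 < 1" using assms by (simp add: abs_square_less_1)
  then have "ln 2 \<le> ln (2 / (1 - (cmod w)\<^sup>2))"
    by (intro ln_mono) (auto simp: field_simps)
  moreover have "1 / 2 \<le> ln (2::real)"
    using ln_le_minus_one[of "1 / 2"] by (simp add: ln_div)
  ultimately show ?thesis by linarith
qed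

text \<open>The test functions are \<open>bloch_log b\<close>, the powers and
  \<open>disk_automorphism b\<close>, of Bloch norm at most 3, 3 and 2. The third bound stays
  pointwise in \<open>z\<close>; integration over the disk comes afterwards.\<close>

lemma opnorm_lower_bounds:
  assumes u: "u holomorphic_on ball 0 1" and \<phi>: "self_map_disk \<phi>"
    and N: "wcomp_opnorm_bloch u \<phi> = ennreal N" "0 \<le> N"
  shows "cmod (u 0) * ln (2 / (1 - (cmod (\<phi> 0))\<^sup>2)) \<le> 3 * N"
    and "bloch_norm (\<lambda>z. u z * \<phi> z ^ n) \<le> ennreal (3 * N)"
    and "\<lbrakk>a \<in> ball 0 1; z \<in> ball 0 1\<rbrakk> \<Longrightarrow>
      ln (2 / (1 - (cmod (\<phi> a))\<^sup>2)) * cmod (u (disk_automorphism a z) - u a)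
      \<le> N * (7 * (- ln (1 - cmod z)) + 4 * (- ln (1 - cmod z))\<^sup>2)"
proof -
  have \<phi>_disk: "\<phi> z \<in> ball 0 1" if "z \<in> ball 0 1" for z
    using \<phi> that unfolding self_map_disk_def by blast
  have ln2: "ln 2 \<le> (1::real)" "0 < ln (2::real)" using ln_2_less_1 by auto
  have L_pos: "0 \<le> ln (2 / (1 - (cmod w)\<^sup>2))" if "w \<in> ball 0 1" for w :: complex
    using ln_two_div_ge_half[OF that] by simp
  have log_norm: "bloch_norm (wcomp u \<phi> (bloch_log b)) \<le> ennreal (N * 3)" if b: "b \<in> ball 0 1" for b
    using bloch_norm_wcomp_test[OF u \<phi> bloch_log_holomorphic[OF b] N, of 1 2] bloch_log_deriv_le[OF b] ln2
    by simp
  show "cmod (u 0) * ln (2 / (1 - (cmod (\<phi> 0))\<^sup>2)) \<le> 3 * N"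
  proof -
    have \<phi>0: "\<phi> 0 \<in> ball 0 1" by (rule \<phi>_disk) simp
    from bloch_norm_leD[OF log_norm[OF \<phi>0], of 0] N
    have "cmod (u 0 * bloch_log (\<phi> 0) (\<phi> 0)) \<le> N * 3"
      using norm_ge_zero[of "deriv (wcomp u \<phi> (bloch_log (\<phi> 0))) 0"]
      by (simp add: wcomp_def del: norm_ge_zero)
    then show ?thesis
      using L_pos[OF \<phi>0] by (simp add: bloch_log_self[OF \<phi>0] norm_mult)
  qed
  show "bloch_norm (\<lambda>z. u z * \<phi> z ^ n) \<le> ennreal (3 * N)"
  proof -
    have "bloch_norm (wcomp u \<phi> (\<lambda>w. w ^ n)) \<le> ennreal (N * (1 + 2))"
      by (rule bloch_norm_wcomp_test[OF u \<phi> _ N])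
         (auto intro!: holomorphic_intros power_deriv_le[simplified] simp: power_0_left)
    then show ?thesis by (simp add: wcomp_def mult.commute)
  qed
  assume a: "a \<in> ball 0 1" and z: "z \<in> ball 0 1"
  define b where "b = \<phi> a"
  have b: "b \<in> ball 0 1" unfolding b_def by (rule \<phi>_disk[OF a])
  define L where "L = ln (2 / (1 - (cmod b)\<^sup>2))"
  define l where "l = - ln (1 - cmod z)"
  have l: "0 \<le> l" using z by (simp add: l_def)
  define z' where "z' = disk_automorphism a z"
  have z': "z' \<in> ball 0 1" unfolding z'_def by (rule disk_automorphism_in_disk[OF a z])
  \<comment> \<open>This map fixes 0, because 0 goes to \<open>a\<close>, then to \<open>b\<close>,
    then back to 0; hence the Schwarz lemma applies.\<close>
  define \<psi> where "\<psi> = (\<lambda>z. disk_automorphism b (\<phi> (disk_automorphism a z)))"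
  have \<psi>_disk: "\<psi> z \<in> ball 0 1" if "z \<in> ball 0 1" for z
    unfolding \<psi>_def by (intro disk_automorphism_in_disk b \<phi>_disk a that)
  have "\<psi> holomorphic_on ball 0 1"
  proof -
    have "(\<phi> \<circ> disk_automorphism a) holomorphic_on ball 0 1"
      using holomorphic_on_disk_automorphism[OF a] \<phi> disk_automorphism_in_disk[OF a]
      by (intro holomorphic_on_compose_gen[where t = "ball 0 1"]) (auto simp: self_map_disk_def)
    moreover have "(\<phi> \<circ> disk_automorphism a) ` ball 0 1 \<subseteq> ball 0 1"
      using \<phi>_disk disk_automorphism_in_disk[OF a] by (simp add: image_subset_iff)
    ultimately have "(disk_automorphism b \<circ> (\<phi> \<circ> disk_automorphism a)) holomorphic_on ball 0 1"
      by (intro holomorphic_on_compose_gen[OF _ holomorphic_on_disk_automorphism[OF b]])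
    then show ?thesis by (simp add: \<psi>_def o_def)
  qed
  then have w_le: "cmod (\<psi> z) \<le> cmod z"
    using \<psi>_disk z by (intro Schwarz_Lemma(1)) (auto simp: \<psi>_def b_def)
  define w where "w = \<psi> z"
  have w: "w \<in> ball 0 1" unfolding w_def by (rule \<psi>_disk[OF z])
  have \<phi>z': "\<phi> z' = disk_automorphism b w"
    unfolding w_def \<psi>_def z'_def[symmetric] by (rule disk_automorphism_involution[OF b \<phi>_disk[OF z'], symmetric])
  have growth: "cmod (wcomp u \<phi> f z' - wcomp u \<phi> f a) \<le> N * K * l"
    if f: "f holomorphic_on ball 0 1" and le: "bloch_norm (wcomp u \<phi> f) \<le> ennreal (N * K)" and K: "0 \<le> K" for f K
    unfolding z'_def l_def
  proof (rule bloch_growth_disk_automorphism[OF wcomp_holomorphic[OF u \<phi> f] _ a z])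
    fix x :: complex assume x: "x \<in> ball 0 1"
    show "(1 - (cmod x)\<^sup>2) * cmod (deriv (wcomp u \<phi> f) x) \<le> N * K"
      using bloch_norm_leD[OF le x] N K norm_ge_zero[of "wcomp u \<phi> f 0"]
        mult_nonneg_nonneg[of N K] by linarith
  qed
  have h: "cmod (u z' * bloch_log b (\<phi> z') - u a * L) \<le> N * 3 * l"
    using growth[OF bloch_log_holomorphic[OF b] log_norm[OF b]] bloch_log_self[OF b]
    by (simp add: wcomp_def L_def b_def)
  have q: "cmod (u z') * cmod w \<le> N * 2 * l"
  proof -
    have "(1 - (cmod x)\<^sup>2) * cmod (deriv (disk_automorphism b) x) \<le> 1" if "x \<in> ball 0 1" for x
      unfolding deriv_disk_automorphism_norm[OF b that] by simp
    then have "bloch_norm (wcomp u \<phi> (disk_automorphism b)) \<le> ennreal (N * (1 + 1))"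
      using b by (intro bloch_norm_wcomp_test[OF u \<phi> holomorphic_on_disk_automorphism[OF b] N]) auto
    from growth[OF holomorphic_on_disk_automorphism[OF b], of 2] this
    have "cmod (wcomp u \<phi> (disk_automorphism b) z' - wcomp u \<phi> (disk_automorphism b) a) \<le> N * 2 * l"
      by simp
    moreover have "wcomp u \<phi> (disk_automorphism b) z' = u z' * w" "wcomp u \<phi> (disk_automorphism b) a = 0"
      by (simp_all add: wcomp_def w_def \<psi>_def z'_def b_def)
    ultimately show ?thesis by (simp add: norm_mult)
  qed
  have "cmod (bloch_log b (\<phi> z') - L) \<le> 2 * (- ln (1 - cmod w))"
    using bloch_growth_disk_automorphism[OF bloch_log_holomorphic[OF b] bloch_log_deriv_le[OF b] b w]
    by (simp add: \<phi>z' bloch_log_self[OF b] L_def)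
  \<comment> \<open>The factor \<open>|w|\<close> is extracted so that the estimate \<open>q\<close>
    for \<open>|u z'| * |w|\<close> can be used.\<close>
  also have "\<dots> \<le> 2 * (cmod w * (1 - ln (1 - cmod w)))"
    using w by (intro mult_left_mono neg_ln_one_minus_le) auto
  also have "\<dots> \<le> 2 * (cmod w * (1 + l))"
    using w_le z w by (intro mult_left_mono) (auto simp: l_def w_def)
  finally have "cmod (u z') * cmod (bloch_log b (\<phi> z') - L) \<le> cmod (u z') * (2 * (cmod w * (1 + l)))"
    by (rule mult_left_mono) simp
  also have "\<dots> = 2 * (1 + l) * (cmod (u z') * cmod w)" by simp
  also have "\<dots> \<le> 2 * (1 + l) * (N * 2 * l)"
    using q l by (intro mult_left_mono) auto
  finally have p: "cmod (u z' * (bloch_log b (\<phi> z') - L)) \<le> 2 * (1 + l) * (N * 2 * l)"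
    by (simp add: norm_mult)
  have "L * (u z' - u a) = (u z' * bloch_log b (\<phi> z') - u a * L) - u z' * (bloch_log b (\<phi> z') - L)"
    by (simp add: algebra_simps)
  then have "cmod (L * (u z' - u a)) \<le> N * 3 * l + 2 * (1 + l) * (N * 2 * l)"
    using norm_triangle_ineq4[of "u z' * bloch_log b (\<phi> z') - u a * L" "u z' * (bloch_log b (\<phi> z') - L)"] h p
    by simp
  \<comment> \<open>Here \<open>3 * l + 4 * l * (1 + l) = 7 * l + 4 * l^2\<close>, the source of the
    polynomial.\<close>
  also have "\<dots> = N * (7 * l + 4 * l\<^sup>2)" by (simp add: algebra_simps power2_eq_square)
  finally show "ln (2 / (1 - (cmod (\<phi> a))\<^sup>2)) * cmod (u (disk_automorphism a z) - u a)
      \<le> N * (7 * (- ln (1 - cmod z)) + 4 * (- ln (1 - cmod z))\<^sup>2)"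
    using L_pos[OF b] unfolding L_def[symmetric] l_def[symmetric] z'_def[symmetric] b_def[symmetric]
    by (simp add: norm_mult)
qed

subsection \<open>Upper bound for the operator norm\<close>

text \<open>With \<open>n\<close> the integer part of \<open>1 / (2 * (1 - r))\<close>, Bernoulli
  gives \<open>r^n >= 1/2\<close>, while \<open>n + 1\<close> is at least
  \<open>1 / (2 * (1 - r))\<close>. The factor \<open>Suc n\<close> matches the derivative of the
  power \<open>Suc n\<close>.\<close>

lemma inverse_one_minus_le_power:
  assumes "0 \<le> r" "r < (1::real)"
  obtains n where "1 / (1 - r) \<le> 4 * (real (Suc n) * r ^ n)"
proof -
  define x where "x = 1 / (1 - r) / 2"
  define n where "n = nat \<lfloor>x\<rfloor>"
  have "0 \<le> x" using assms by (simp add: x_def)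
  then have n: "real n \<le> x" "x \<le> real (Suc n)"
    unfolding n_def by linarith+
  have "real n * (1 - r) \<le> 1 / 2"
    using n(1) assms by (simp add: x_def field_simps)
  moreover have "1 + real n * (r - 1) \<le> (1 + (r - 1)) ^ n"
    using assms by (intro Bernoulli_inequality) auto
  ultimately have "1 / 2 \<le> r ^ n" by (simp add: algebra_simps)
  then have "x * (1 / 2) \<le> real (Suc n) * r ^ n"
    using n \<open>0 \<le> x\<close> by (intro mult_mono) auto
  moreover have "1 / (1 - r) = 4 * (x * (1 / 2))"
    unfolding x_def using assms by (simp add: frac_eq_eq)
  ultimately have "1 / (1 - r) \<le> 4 * (real (Suc n) * r ^ n)" by linarith
  then show ?thesis by (rule that)
qed

text \<open>The 2 in front of \<open>T1\<close> is the growth constant of \<open>f\<close>;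
  \<open>6 = 2 * 3\<close> combines it with the Bergman bound for the derivative;
  \<open>8 = 4 * 2\<close> combines the choice of power with two uses of \<open>K\<close>.\<close>

lemma opnorm_upper_bound:
  assumes u: "u holomorphic_on ball 0 1" and \<phi>: "self_map_disk \<phi>"
    and T1: "cmod (u 0) * ln (2 / (1 - (cmod (\<phi> 0))\<^sup>2)) \<le> T1"
    and K: "\<And>n. bloch_norm (\<lambda>z. u z * \<phi> z ^ n) \<le> ennreal K" "0 \<le> K"
    and T: "\<And>a. a \<in> ball 0 1 \<Longrightarrow> ennreal (ln (2 / (1 - (cmod (\<phi> a))\<^sup>2)))
                     * A2_norm (\<lambda>z. u (disk_automorphism a z) - u a) \<le> ennreal T" "0 \<le> T"
  shows "wcomp_opnorm_bloch u \<phi> \<le> ennreal (2 * T1 + (6 * T + 8 * K))"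
  unfolding wcomp_opnorm_bloch_def
proof (rule SUP_least)
  fix f assume "f \<in> {f. in_bloch f \<and> bloch_norm f \<le> 1}"
  then have f: "f holomorphic_on ball 0 1" "bloch_norm f \<le> ennreal 1"
    by (auto simp: in_bloch_def)
  define L where "L w = ln (2 / (1 - (cmod w)\<^sup>2))" for w :: complex
  note f1 = bloch_norm_leD[OF f(2) _ zero_le_one]
  have \<phi>_disk: "\<phi> z \<in> ball 0 1" if "z \<in> ball 0 1" for z
    using \<phi> that unfolding self_map_disk_def by blast
  have L_ge: "1 / 2 \<le> L w" if "w \<in> ball 0 1" for w
    unfolding L_def by (rule ln_two_div_ge_half[OF that])
  \<comment> \<open>The seminorm of \<open>f\<close> is at most \<open>1 - |f 0|\<close>, and
    \<open>|f 0| <= 2 * |f 0| * L w\<close> by \<open>L_ge\<close>; together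
    \<open>|f w| <= (1 + |f 0|) * L w\<close>.\<close>
  have f_le: "cmod (f w) \<le> 2 * L w" if w: "w \<in> ball 0 1" for w
  proof -
    have f0: "cmod (f 0) \<le> 1"
      using f1[of 0] norm_ge_zero[of "deriv f 0"] by (simp del: norm_ge_zero)
    have "cmod (f w - f 0) \<le> (1 - cmod (f 0)) * (- ln (1 - cmod w))"
      by (rule bloch_growth[OF f(1) _ w]) (use f1 in fastforce)
    also have "\<dots> \<le> (1 - cmod (f 0)) * L w"
      unfolding L_def using w f0 by (intro mult_left_mono neg_ln_one_minus_le_ln) auto
    finally have "cmod (f w - f 0) \<le> (1 - cmod (f 0)) * L w" .
    moreover have "cmod (f 0) * (1 / 2) \<le> cmod (f 0) * L w"
      by (intro mult_left_mono L_ge w) auto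
    moreover have "cmod (f 0) * L w \<le> 1 * L w"
      using L_ge[OF w] f0 by (intro mult_right_mono) auto
    moreover have "cmod (f w) \<le> cmod (f w - f 0) + cmod (f 0)"
      using norm_triangle_ineq[of "f w - f 0" "f 0"] by simp
    ultimately show ?thesis by (simp add: algebra_simps)
  qed
  have at_0: "cmod (wcomp u \<phi> f 0) \<le> 2 * T1"
  proof -
    have "cmod (u 0) * cmod (f (\<phi> 0)) \<le> cmod (u 0) * (2 * L (\<phi> 0))"
      by (intro mult_left_mono f_le \<phi>_disk) auto
    then show ?thesis using T1 by (simp add: wcomp_def norm_mult L_def)
  qed
  have du: "L z' * ((1 - (cmod z)\<^sup>2) * cmod (deriv u z)) \<le> 3 * T"
    if z: "z \<in> ball 0 1" and z': "z' = \<phi> z" for z z'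
  proof -
    let ?g = "\<lambda>w. u (disk_automorphism z w) - u z"
    have hol: "(u \<circ> disk_automorphism z) holomorphic_on ball 0 1"
      using holomorphic_on_disk_automorphism[OF z] u disk_automorphism_in_disk[OF z]
      by (intro holomorphic_on_compose_gen[where t = "ball 0 1"]) (auto simp: image_subset_iff)
    then have holg: "?g holomorphic_on ball 0 1"
      by (intro holomorphic_intros) (simp add: o_def)
    \<comment> \<open>At 0 the automorphism takes the value \<open>z\<close> with derivative
      \<open>- (1 - |z|^2)\<close>, so \<open>|?g'(0)|\<close> is the Bloch quantity of
      \<open>u\<close> at \<open>z\<close>.\<close>
    have "(?g has_field_derivative deriv u z * (- complex_of_real (1 - (cmod z)\<^sup>2))) (at 0)"
    proof -
      have "(u has_field_derivative deriv u z) (at (disk_automorphism z 0))"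
        using u z holomorphic_derivI open_ball by fastforce
      from DERIV_chain2[OF this has_field_derivative_disk_automorphism[OF z, of 0]]
      show ?thesis by (auto intro!: derivative_eq_intros)
    qed
    from DERIV_imp_deriv[OF this]
    have "cmod (deriv ?g 0) = (1 - (cmod z)\<^sup>2) * cmod (deriv u z)"
      using z by (simp add: norm_mult abs_square_le_1 abs_of_nonneg del: of_real_diff)
    with deriv_le_A2_norm[OF holg]
    have "ennreal ((1 - (cmod z)\<^sup>2) * cmod (deriv u z)) \<le> ennreal 3 * A2_norm ?g"
      by simp
    then have "ennreal (L z') * ennreal ((1 - (cmod z)\<^sup>2) * cmod (deriv u z))
               \<le> ennreal (L z') * (ennreal 3 * A2_norm ?g)"
      by (rule mult_left_mono) simp
    also have "\<dots> = ennreal 3 * (ennreal (L z') * A2_norm ?g)" by (simp add: mult_ac)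
    also have "\<dots> \<le> ennreal 3 * ennreal T"
      using T(1)[OF z] unfolding z' L_def by (rule mult_left_mono) simp
    finally have "ennreal (L z') * ennreal ((1 - (cmod z)\<^sup>2) * cmod (deriv u z)) \<le> ennreal 3 * ennreal T" .
    moreover have "0 \<le> L z'" using L_ge[OF \<phi>_disk[OF z]] z' by simp
    ultimately show ?thesis using T(2) by (simp add: ennreal_mult'[symmetric] del: ennreal_numeral)
  qed
  have d\<phi>: "(1 - (cmod z)\<^sup>2) * cmod (u z * deriv \<phi> z) \<le> 8 * K * (1 - (cmod (\<phi> z))\<^sup>2)"
    if z: "z \<in> ball 0 1" for z
  proof -
    define r where "r = cmod (\<phi> z)"
    have r: "0 \<le> r" "r < 1" using \<phi>_disk[OF z] by (auto simp: r_def)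
    have sq: "0 \<le> 1 - (cmod z)\<^sup>2" using z by (simp add: abs_square_le_1)
    have D: "deriv (\<lambda>z. u z * \<phi> z ^ n) z
             = deriv u z * \<phi> z ^ n + u z * (of_nat n * \<phi> z ^ (n - 1) * deriv \<phi> z)" for n
    proof -
      have "deriv (\<lambda>w. w ^ n) (\<phi> z) = of_nat n * \<phi> z ^ (n - 1)"
        by (rule DERIV_imp_deriv) (auto intro!: derivative_eq_intros)
      then show ?thesis
        using deriv_wcomp[OF u \<phi>, of "\<lambda>w. w ^ n" z] z by (simp add: wcomp_def holomorphic_intros)
    qed
    have K': "(1 - (cmod z)\<^sup>2) * cmod (deriv (\<lambda>z. u z * \<phi> z ^ n) z) \<le> K" for n
      using bloch_norm_leD[OF K(1)[of n] z K(2)] norm_ge_zero[of "u 0 * \<phi> 0 ^ n"] by linarith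
    \<comment> \<open>Exponent 0 bounds \<open>u\<close> itself; this removes the term with
      \<open>deriv u\<close> from the product rule for \<open>Suc n\<close>, leaving
      \<open>2 * K\<close>.\<close>
    have du_K: "(1 - (cmod z)\<^sup>2) * cmod (deriv u z) \<le> K" using K'[of 0] by simp
    obtain n where n: "1 / (1 - r) \<le> 4 * (real (Suc n) * r ^ n)"
      using inverse_one_minus_le_power[OF r] by blast
    define X where "X = (1 - (cmod z)\<^sup>2) * cmod (u z * deriv \<phi> z)"
    have "0 \<le> X" using sq by (simp add: X_def)
    have "X * (real (Suc n) * r ^ n)
          = (1 - (cmod z)\<^sup>2) * cmod (u z * (of_nat (Suc n) * \<phi> z ^ n * deriv \<phi> z))"
      by (simp only: X_def r_def norm_mult norm_power norm_of_nat mult_ac)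
    also have "u z * (of_nat (Suc n) * \<phi> z ^ n * deriv \<phi> z)
          = deriv (\<lambda>z. u z * \<phi> z ^ Suc n) z - deriv u z * \<phi> z ^ Suc n"
      unfolding D by simp
    also have "(1 - (cmod z)\<^sup>2) * cmod (deriv (\<lambda>z. u z * \<phi> z ^ Suc n) z - deriv u z * \<phi> z ^ Suc n)
          \<le> (1 - (cmod z)\<^sup>2) * (cmod (deriv (\<lambda>z. u z * \<phi> z ^ Suc n) z) + cmod (deriv u z) * 1)"
    proof (intro mult_left_mono sq order_trans[OF norm_triangle_ineq4] add_left_mono)
      show "cmod (deriv u z * \<phi> z ^ Suc n) \<le> cmod (deriv u z) * 1"
        unfolding norm_mult norm_power r_def[symmetric]
        using r by (intro mult_left_mono power_le_one) auto
    qed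
    also have "\<dots> \<le> 2 * K"
      using K'[of "Suc n"] du_K by (simp add: distrib_left)
    finally have X_le: "X * (real (Suc n) * r ^ n) \<le> 2 * K" .
    have "X * (1 / (1 - r)) \<le> X * (4 * (real (Suc n) * r ^ n))"
      by (intro mult_left_mono n \<open>0 \<le> X\<close>)
    also have "\<dots> = 4 * (X * (real (Suc n) * r ^ n))"
      by (rule mult.left_commute)
    also have "\<dots> \<le> 8 * K" using X_le by linarith
    finally have "X \<le> 8 * K * (1 - r)" using r by (simp add: field_simps)
    \<comment> \<open>Passes to the weight carried by the Bloch seminorm of \<open>f\<close> at
      \<open>\<phi> z\<close>.\<close>
    also have "\<dots> \<le> 8 * K * (1 - r\<^sup>2)"
      using r K(2) by (intro mult_left_mono) (auto simp: power2_eq_square mult_left_le)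
    finally show ?thesis by (simp add: X_def r_def)
  qed
  have deriv_le: "(1 - (cmod z)\<^sup>2) * cmod (deriv (wcomp u \<phi> f) z) \<le> 6 * T + 8 * K"
    if z: "z \<in> ball 0 1" for z
  proof -
    have sq: "0 \<le> 1 - (cmod z)\<^sup>2" using z by (simp add: abs_square_le_1)
    have "(1 - (cmod z)\<^sup>2) * cmod (deriv u z) * cmod (f (\<phi> z))
          \<le> (1 - (cmod z)\<^sup>2) * cmod (deriv u z) * (2 * L (\<phi> z))"
      using sq by (intro mult_left_mono f_le \<phi>_disk z) auto
    also have "\<dots> = 2 * (L (\<phi> z) * ((1 - (cmod z)\<^sup>2) * cmod (deriv u z)))"
      by (simp only: mult_ac)
    also have "\<dots> \<le> 6 * T" using du[OF z refl] by linarith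
    finally have 1: "(1 - (cmod z)\<^sup>2) * cmod (deriv u z) * cmod (f (\<phi> z)) \<le> 6 * T" .
    have "(1 - (cmod z)\<^sup>2) * cmod (u z * deriv \<phi> z) * cmod (deriv f (\<phi> z))
          \<le> 8 * K * (1 - (cmod (\<phi> z))\<^sup>2) * cmod (deriv f (\<phi> z))"
      by (intro mult_right_mono d\<phi> z) auto
    also have "\<dots> = 8 * K * ((1 - (cmod (\<phi> z))\<^sup>2) * cmod (deriv f (\<phi> z)))" by simp
    also have "\<dots> \<le> 8 * K * 1"
      using f1[OF \<phi>_disk[OF z]] norm_ge_zero[of "f 0"] K(2)
      by (intro mult_left_mono) (linarith, simp)
    finally have 2: "(1 - (cmod z)\<^sup>2) * cmod (u z * deriv \<phi> z) * cmod (deriv f (\<phi> z)) \<le> 8 * K" by simp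
    have "(1 - (cmod z)\<^sup>2) * cmod (deriv (wcomp u \<phi> f) z)
          \<le> (1 - (cmod z)\<^sup>2) * (cmod (deriv u z * f (\<phi> z)) + cmod (u z * (deriv f (\<phi> z) * deriv \<phi> z)))"
      unfolding deriv_wcomp[OF u \<phi> f(1) z] by (intro mult_left_mono norm_triangle_ineq sq)
    also have "\<dots> = (1 - (cmod z)\<^sup>2) * cmod (deriv u z) * cmod (f (\<phi> z))
        + (1 - (cmod z)\<^sup>2) * cmod (u z * deriv \<phi> z) * cmod (deriv f (\<phi> z))"
      by (simp add: norm_mult distrib_left mult_ac)
    finally show ?thesis using 1 2 by linarith
  qed
  show "bloch_norm (wcomp u \<phi> f) \<le> ennreal (2 * T1 + (6 * T + 8 * K))"
    by (rule bloch_norm_leI[OF at_0 deriv_le])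
qed

section \<open>The two-sided estimate with absolute constants\<close>

theorem theorem2p13:
  "\<exists>c C :: real. c > 0 \<and> C > 0 \<and>
     (\<forall>u \<phi>. u holomorphic_on ball 0 1 \<longrightarrow> self_map_disk \<phi> \<longrightarrow> wcomp_bounded_bloch u \<phi> \<longrightarrow>
       (let R = ennreal (cmod (u 0) * ln (2 / (1 - (cmod (\<phi> 0))\<^sup>2)))
              + (SUP n::nat. bloch_norm (\<lambda>z. u z * (\<phi> z) ^ n))
              + (SUP a\<in>ball 0 1. ennreal (ln (2 / (1 - (cmod (\<phi> a))\<^sup>2)))
                     * A2_norm (\<lambda>z. u (disk_automorphism a z) - u a))
        in ennreal c * R \<le> wcomp_opnorm_bloch u \<phi> \<and> wcomp_opnorm_bloch u \<phi> \<le> ennreal C * R))"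
proof -
  obtain D :: real where D: "D > 0"
    "\<And>g B. 0 \<le> B \<Longrightarrow>
       (\<And>z. z \<in> ball 0 1 \<Longrightarrow> cmod (g z) \<le> B * (7 * (- ln (1 - cmod z)) + 4 * (- ln (1 - cmod z))\<^sup>2)) \<Longrightarrow>
       A2_norm g \<le> ennreal (D * B)"
    using A2_norm_log_polynomial_bound by blast
  \<comment> \<open>The three terms are at most \<open>3 * N\<close>, \<open>3 * N\<close> and
    \<open>D * N\<close>.\<close>
  define c where "c = 1 / (6 + D)"
  have "c > 0" using D by (simp add: c_def)
  have main: "ennreal c * (ennreal T1 + S2 + S3) \<le> wcomp_opnorm_bloch u \<phi> \<and>
              wcomp_opnorm_bloch u \<phi> \<le> ennreal 8 * (ennreal T1 + S2 + S3)"
    if u: "u holomorphic_on ball 0 1" and \<phi>: "self_map_disk \<phi>" and bdd: "wcomp_bounded_bloch u \<phi>"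
      and T1: "T1 = cmod (u 0) * ln (2 / (1 - (cmod (\<phi> 0))\<^sup>2))"
      and S2: "S2 = (SUP n::nat. bloch_norm (\<lambda>z. u z * (\<phi> z) ^ n))"
      and S3: "S3 = (SUP a\<in>ball 0 1. ennreal (ln (2 / (1 - (cmod (\<phi> a))\<^sup>2)))
                     * A2_norm (\<lambda>z. u (disk_automorphism a z) - u a))"
    for u \<phi> T1 S2 S3
  proof -
    obtain N where N: "wcomp_opnorm_bloch u \<phi> = ennreal N" "0 \<le> N"
      using wcomp_opnorm_bloch_finite[OF bdd] by (metis ennreal_cases infinity_ennreal_def less_irrefl)
    have \<phi>_disk: "\<phi> z \<in> ball 0 1" if "z \<in> ball 0 1" for z
      using \<phi> that unfolding self_map_disk_def by blast
    have L_pos: "0 < ln (2 / (1 - (cmod (\<phi> a))\<^sup>2))" if "a \<in> ball 0 1" for a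
      using ln_two_div_ge_half[OF \<phi>_disk[OF that]] by linarith
    note lower = opnorm_lower_bounds[OF u \<phi> N]
    have S2_le: "S2 \<le> ennreal (3 * N)"
      unfolding S2 by (intro SUP_least lower(2))
    have S3_le: "S3 \<le> ennreal (D * N)"
      unfolding S3
    proof (rule SUP_least)
      fix a :: complex assume a: "a \<in> ball 0 1"
      define L where "L = ln (2 / (1 - (cmod (\<phi> a))\<^sup>2))"
      have L: "0 < L" unfolding L_def by (rule L_pos[OF a])
      \<comment> \<open>For fixed \<open>a\<close> the weight \<open>L\<close> is a positive
        constant: it is divided into \<open>N\<close> here and multiplied back after
        integration.\<close>
      have "A2_norm (\<lambda>z. u (disk_automorphism a z) - u a) \<le> ennreal (D * (N / L))"
      proof (rule D(2))
        fix z :: complex assume z: "z \<in> ball 0 1"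
        show "cmod (u (disk_automorphism a z) - u a)
              \<le> N / L * (7 * (- ln (1 - cmod z)) + 4 * (- ln (1 - cmod z))\<^sup>2)"
          using lower(3)[OF a z] L unfolding L_def[symmetric]
          by (simp add: pos_le_divide_eq mult.commute)
      qed (use N L in simp)
      then have "ennreal L * A2_norm (\<lambda>z. u (disk_automorphism a z) - u a)
                 \<le> ennreal L * ennreal (D * (N / L))"
        by (rule mult_left_mono) simp
      also have "\<dots> = ennreal (D * N)"
        using L by (simp add: ennreal_mult'[symmetric])
      finally show "ennreal (ln (2 / (1 - (cmod (\<phi> a))\<^sup>2))) *
          A2_norm (\<lambda>z. u (disk_automorphism a z) - u a) \<le> ennreal (D * N)"
        by (simp add: L_def)
    qed
    \<comment> \<open>The lower bounds make both suprema finite, so the upper bound can be applied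
      with real numbers.\<close>
    obtain K where K: "S2 = ennreal K" "0 \<le> K"
      using S2_le by (metis ennreal_cases ennreal_neq_top top.extremum_unique)
    obtain T where T: "S3 = ennreal T" "0 \<le> T"
      using S3_le by (metis ennreal_cases ennreal_neq_top top.extremum_unique)
    have "0 \<le> T1"
      using L_pos[of 0] by (simp add: T1)
    then have R: "ennreal T1 + S2 + S3 = ennreal (T1 + K + T)"
      using K T by simp
    have "K \<le> 3 * N" "T \<le> D * N"
      using S2_le S3_le K T N D by (simp_all add: ennreal_le_iff)
    then have "T1 + K + T \<le> (6 + D) * N"
      using lower(1) by (simp add: T1 algebra_simps)
    then have "c * (T1 + K + T) \<le> N"
      using D by (simp add: c_def field_simps)
    then have "ennreal c * (ennreal T1 + S2 + S3) \<le> ennreal N"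
      unfolding R using \<open>c > 0\<close> by (simp add: ennreal_mult'[symmetric] ennreal_leI)
    moreover have "wcomp_opnorm_bloch u \<phi> \<le> ennreal (2 * T1 + (6 * T + 8 * K))"
    proof (rule opnorm_upper_bound[OF u \<phi>])
      show "bloch_norm (\<lambda>z. u z * \<phi> z ^ n) \<le> ennreal K" for n
        unfolding K(1)[symmetric] S2 by (rule SUP_upper) simp
      show "ennreal (ln (2 / (1 - (cmod (\<phi> a))\<^sup>2))) *
          A2_norm (\<lambda>z. u (disk_automorphism a z) - u a) \<le> ennreal T" if "a \<in> ball 0 1" for a
        unfolding T(1)[symmetric] S3 using that by (rule SUP_upper)
    qed (use K T T1 in auto)
    \<comment> \<open>The constant 8 is the largest of 2, 6 and 8.\<close>
    moreover have "ennreal (2 * T1 + (6 * T + 8 * K)) \<le> ennreal (8 * (T1 + K + T))"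
      using \<open>0 \<le> T1\<close> K T by (intro ennreal_leI) simp
    moreover have "ennreal (8 * (T1 + K + T)) = ennreal 8 * (ennreal T1 + S2 + S3)"
      unfolding R using \<open>0 \<le> T1\<close> K T by (intro ennreal_mult) auto
    ultimately show ?thesis
      using N by auto
  qed
  show ?thesis
    by (rule exI[of _ c], rule exI[of _ 8]) (use main \<open>c > 0\<close> in \<open>auto simp: Let_def simp del: ennreal_numeral\<close>)
qed

end
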